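(* Let $0<\alpha<1$. If $K$ is a compact subset of $\mathbb R^n$, then $$\mathrm{cap}(K;\dot{\Lambda}_\alpha^{1,1})=2\inf_{O\in\mathsf{O}^\infty(K)}P_\alpha(O),$$ where $\mathsf{O}^\infty(K)$ denotes the class of all open sets (in $\mathbb R^n$) with $C^\infty$ boundary that contain $K$.
   Context: $C_0^\infty$ is the class of all smooth functions with compact support in $\mathbb R^n$, and $1_E$ is the indicator function of a set $E\subset\mathbb R^n$. For $f\in C_0^\infty$, $$\|f\|_{\dot{\Lambda}_\alpha^{1,1}}=\int_{\mathbb R^n}\left(\int_{\mathbb R^n}|f(x+h)-f(x)|\,dx\right)\frac{dh}{|h|^{n+\alpha}}.$$ The fractional Sobolev capacity of a compact set $K\subset\mathbb R^n$ is $$\mathrm{cap}(K;\dot{\Lambda}_\alpha^{1,1})=\inf\big\{\|f\|_{\dot{\Lambda}_\alpha^{1,1}}:\ f\in C_0^\infty,\ f\ge 1_K\big\}.$$ The fractional $\alpha$-perimeter of a set $E\subset\mathbb R^n$, with $E^c=\mathbb R^n\setminus E$, is $$P_\alpha(E)=\int_E\int_{E^c}\frac{dx\,dy}{|x-y|^{n+\alpha}},$$ so that $\|1_E\|_{\dot{\Lambda}_\alpha^{1,1}}=2P_\alpha(E)$.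
   Formalization: The open sets with smooth boundary in the class O^∞(K) are additionally required to be bounded; without this the identity fails, since O = R^n has empty boundary and zero perimeter while a closed ball K has positive capacity. *)

theory Defs
  imports "HOL-Analysis.Analysis"
begin

fun higher_differentiable_on ::
  "'a::real_normed_vector set \<Rightarrow> ('a \<Rightarrow> 'b::real_normed_vector) \<Rightarrow> nat \<Rightarrow> bool" where
  "higher_differentiable_on S f 0 \<longleftrightarrow> continuous_on S f"
| "higher_differentiable_on S f (Suc k) \<longleftrightarrow>
     (\<forall>x\<in>S. f differentiable (at x)) \<and>
     (\<forall>v. higher_differentiable_on S (\<lambda>x. frechet_derivative f (at x) v) k)"

text \<open>Intended for open \<open>S\<close> only, since the derivatives are taken at \<open>x\<close> and not within \<open>S\<close>.\<close>

definition smooth_on :: "'a::real_normed_vector set \<Rightarrow> ('a \<Rightarrow> 'b::real_normed_vector) \<Rightarrow> bool" where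
  "smooth_on S f \<longleftrightarrow> (\<forall>k. higher_differentiable_on S f k)"

definition test_functions :: "('a::euclidean_space \<Rightarrow> real) set" where
  "test_functions = {f. smooth_on UNIV f \<and> compact (closure {x. f x \<noteq> 0})}"

definition frac_sobolev_norm :: "real \<Rightarrow> ('a::euclidean_space \<Rightarrow> real) \<Rightarrow> ennreal" where
  "frac_sobolev_norm \<alpha> f =
     (\<integral>\<^sup>+h. (\<integral>\<^sup>+x. ennreal \<bar>f (x + h) - f x\<bar> \<partial>lborel)
            / ennreal (norm h powr (real DIM('a) + \<alpha>)) \<partial>lborel)"

definition frac_sobolev_cap :: "real \<Rightarrow> 'a::euclidean_space set \<Rightarrow> ennreal" where
  "frac_sobolev_cap \<alpha> K =
     (INF f\<in>{f \<in> test_functions. \<forall>x. indicator K x \<le> f x}. frac_sobolev_norm \<alpha> f)"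

definition frac_perimeter :: "real \<Rightarrow> 'a::euclidean_space set \<Rightarrow> ennreal" where
  "frac_perimeter \<alpha> E =
     (\<integral>\<^sup>+x\<in>E. (\<integral>\<^sup>+y\<in>- E. ennreal (1 / norm (x - y) powr (real DIM('a) + \<alpha>)) \<partial>lborel) \<partial>lborel)"

text \<open>The usual notion of a \<open>C\<^sup>\<infinity>\<close> boundary: near each boundary point, and up to choosing a
  coordinate axis \<open>b\<close> and its orientation \<open>s\<close>, the set is the strict epigraph of a smooth
  function \<open>g\<close> of the remaining coordinates. A function of the remaining coordinates is written as
  a function on the whole space evaluated at the projection of \<open>x\<close> to the hyperplane orthogonal
  to \<open>b\<close>.\<close>

definition smooth_boundary :: "'a::euclidean_space set \<Rightarrow> bool" where
  "smooth_boundary U \<longleftrightarrow>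
     (\<forall>p\<in>frontier U. \<exists>r>0. \<exists>b\<in>Basis. \<exists>s\<in>{-1, 1}. \<exists>g :: 'a \<Rightarrow> real.
        smooth_on UNIV g \<and>
        U \<inter> ball p r = {x \<in> ball p r. g (x - (x \<bullet> b) *\<^sub>R b) < s * (x \<bullet> b)})"

text \<open>Boundedness is essential: the whole space has empty boundary and zero perimeter, and
  complements of small balls away from \<open>K\<close> have arbitrarily small perimeter.\<close>

definition smooth_open_nbhds :: "'a::euclidean_space set \<Rightarrow> 'a set set" where
  "smooth_open_nbhds K = {U. open U \<and> bounded U \<and> smooth_boundary U \<and> K \<subseteq> U}"

end

theory Submission
  imports Defs
begin

text \<open>For the upper bound, mollify \<open>1\<^sub>U\<close>: convolution with a probability density does not increase
  the seminorm, and the result is a test function equal to 1 on \<open>K\<close>; smoothness of the boundary of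
  \<open>U\<close> plays no role.

  For the lower bound, the coarea formula writes the seminorm of \<open>f\<close> as the integral over \<open>t\<close> of
  twice the perimeters of \<open>{f > t}\<close>, and for \<open>0 < t < 1\<close> these sets contain \<open>K\<close>. For regular values
  \<open>t\<close> they have smooth boundary. Sard's theorem is avoided by first adding a small linear function
  \<open>a \<bullet> x\<close> (cut off far away, at a small cost in the seminorm): for almost every \<open>a\<close>, almost every
  \<open>t\<close> is a regular value.\<close>

section \<open>Functions of class \<open>C\<^sup>k\<close> on the whole space\<close>

text \<open>The definition of \<open>smooth_boundary\<close> asks for a graph function that is
  smooth on the whole space, so a local implicit function would leave an extension problem. This is
  why the implicit function theorem is proved in a global form. The lower bound balances one
  parameter \<epsilon>. The added term is at most \<epsilon> in absolute value, so thresholds in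
  (\<epsilon>, 1 - \<epsilon>) give sets that contain \<open>K\<close> and stay where the cutoff
  equals 1; the cutoff may therefore be merely Lipschitz. The seminorm of the added term is at most
  2 \<epsilon> C, with C finite because min(1, |h|) / |h|^(n + \<alpha>) is integrable for 0 <
  \<alpha> < 1. With I the infimum of the perimeters, integration over the thresholds yields 2 I (1
  - 2 \<epsilon>) \<le> ||f|| + 2 \<epsilon> C, and \<epsilon> tends to 0.\<close>

lemma higher_differentiable_on_SucI:
  assumes "\<And>x. (f has_derivative D x) (at x)"
    and "\<And>v. higher_differentiable_on UNIV (\<lambda>x. D x v) k"
  shows "higher_differentiable_on UNIV f (Suc k)"
proof -
  have "frechet_derivative f (at x) = D x" for x
    using frechet_derivative_at[OF assms(1)] by simp
  then show ?thesis
    using assms by (auto simp: differentiable_def)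
qed

lemma higher_differentiable_on_SucD:
  assumes "higher_differentiable_on UNIV f (Suc k)"
  shows "(f has_derivative frechet_derivative f (at x)) (at x)"
    and "higher_differentiable_on UNIV (\<lambda>x. frechet_derivative f (at x) v) k"
  using assms by (auto simp: frechet_derivative_works)

lemma higher_differentiable_on_Suc_lower:
  "higher_differentiable_on UNIV f (Suc k) \<Longrightarrow> higher_differentiable_on UNIV f k"
proof (induction k arbitrary: f)
  case 0
  then show ?case
    by (auto intro!: continuous_at_imp_continuous_on differentiable_imp_continuous_within)
next
  case (Suc k)
  show ?case
    by (rule higher_differentiable_on_SucI[OF higher_differentiable_on_SucD(1)[OF Suc.prems]])
      (intro Suc.IH higher_differentiable_on_SucD(2)[OF Suc.prems])
qed

lemma higher_differentiable_on_const: "higher_differentiable_on UNIV (\<lambda>x. c) k"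
proof (induction k arbitrary: c)
  case (Suc k)
  show ?case
    by (rule higher_differentiable_on_SucI[where D="\<lambda>_ _. 0"]) (auto intro: Suc)
qed simp

lemma higher_differentiable_on_add:
  assumes "higher_differentiable_on UNIV f k" "higher_differentiable_on UNIV g k"
  shows "higher_differentiable_on UNIV (\<lambda>x. f x + g x) k"
  using assms
proof (induction k arbitrary: f g)
  case 0
  then show ?case by (auto intro: continuous_on_add)
next
  case (Suc k)
  note f = higher_differentiable_on_SucD[OF Suc.prems(1)]
  note g = higher_differentiable_on_SucD[OF Suc.prems(2)]
  show ?case
    by (rule higher_differentiable_on_SucI[OF has_derivative_add[OF f(1) g(1)]])
      (intro Suc.IH f(2) g(2))
qed

lemma higher_differentiable_on_sum:
  assumes "\<And>i. i \<in> I \<Longrightarrow> higher_differentiable_on UNIV (f i) k"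
  shows "higher_differentiable_on UNIV (\<lambda>x. \<Sum>i\<in>I. f i x) k"
  using assms
  by (induction I rule: infinite_finite_induct)
    (auto intro: higher_differentiable_on_const higher_differentiable_on_add)

text \<open>Each term of the product rule pairs one factor, lowered to level \<open>k\<close>, with
  a derivative of the other. Working in the locale covers multiplication, scaling and the inner
  product at once.\<close>

lemma (in bounded_bilinear) higher_differentiable_on_prod:
  assumes "higher_differentiable_on UNIV f k" "higher_differentiable_on UNIV g k"
  shows "higher_differentiable_on UNIV (\<lambda>x. prod (f x) (g x)) k"
  using assms
proof (induction k arbitrary: f g)
  case 0
  then show ?case by (auto intro: continuous_on)
next
  case (Suc k)
  note f = higher_differentiable_on_SucD[OF Suc.prems(1)]
  note g = higher_differentiable_on_SucD[OF Suc.prems(2)]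
  show ?case
    by (rule higher_differentiable_on_SucI[OF FDERIV[OF f(1) g(1)]])
      (intro higher_differentiable_on_add Suc.IH f(2) g(2)
        Suc.prems[THEN higher_differentiable_on_Suc_lower])
qed

lemmas higher_differentiable_on_mult =
  bounded_bilinear.higher_differentiable_on_prod[OF bounded_bilinear_mult]
lemmas higher_differentiable_on_scaleR =
  bounded_bilinear.higher_differentiable_on_prod[OF bounded_bilinear_scaleR]

lemma higher_differentiable_on_bounded_linear:
  assumes "bounded_linear L"
  shows "higher_differentiable_on UNIV L k"
proof (cases k)
  case 0
  then show ?thesis by (simp add: linear_continuous_on assms)
next
  case (Suc m)
  then show ?thesis
    using higher_differentiable_on_SucI[OF bounded_linear_imp_has_derivative[OF assms]]
    by (simp add: higher_differentiable_on_const del: higher_differentiable_on.simps)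
qed

lemma higher_differentiable_on_linear_comp:
  assumes "bounded_linear L" "higher_differentiable_on UNIV f k"
  shows "higher_differentiable_on UNIV (\<lambda>x. L (f x)) k"
  using assms(2)
proof (induction k arbitrary: f)
  case 0
  then show ?case using assms(1) by (auto intro: bounded_linear.continuous_on)
next
  case (Suc k)
  note f = higher_differentiable_on_SucD[OF Suc.prems]
  show ?case
    by (rule higher_differentiable_on_SucI[OF bounded_linear.has_derivative[OF assms(1) f(1)]])
      (intro Suc.IH f(2))
qed

lemma higher_differentiable_on_compose:
  fixes f :: "'b::euclidean_space \<Rightarrow> 'c::real_normed_vector"
  assumes "higher_differentiable_on UNIV f k" "higher_differentiable_on UNIV g k"
  shows "higher_differentiable_on UNIV (\<lambda>x. f (g x)) k"
  using assms
proof (induction k arbitrary: f)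
  case 0
  then show ?case by (auto intro: continuous_on_compose2)
next
  case (Suc k)
  note f = higher_differentiable_on_SucD[OF Suc.prems(1)]
  note g = higher_differentiable_on_SucD[OF Suc.prems(2)]
  \<comment> \<open>The direction \<open>frechet_derivative g (at x) v\<close> moves with
    \<open>x\<close>, whereas the definition controls derivatives of \<open>f\<close> only in a
    fixed direction. Expanding over \<open>Basis\<close> leaves products of fixed-direction
    derivatives of \<open>f\<close>, composed with \<open>g\<close>, and components of the
    derivative of \<open>g\<close>.\<close>
  let ?D = "\<lambda>x v. \<Sum>b\<in>Basis. (frechet_derivative g (at x) v \<bullet> b) *\<^sub>R frechet_derivative f (at (g x)) b"
  have D: "frechet_derivative f (at (g x)) (frechet_derivative g (at x) v) = ?D x v" for x v
  proof -
    interpret bounded_linear "frechet_derivative f (at (g x))"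
      by (rule has_derivative_bounded_linear[OF f(1)])
    show ?thesis
      by (subst euclidean_representation[symmetric]) (simp only: sum scaleR)
  qed
  show ?case
  proof (rule higher_differentiable_on_SucI[where D="?D"])
    show "((\<lambda>x. f (g x)) has_derivative ?D x) (at x)" for x
      using has_derivative_compose[OF g(1) f(1)] unfolding D .
    show "higher_differentiable_on UNIV (\<lambda>x. ?D x v) k" for v
      by (intro higher_differentiable_on_sum higher_differentiable_on_scaleR Suc.IH f(2)
        higher_differentiable_on_linear_comp[OF bounded_linear_inner_left] g(2)
        higher_differentiable_on_Suc_lower[OF Suc.prems(2)])
  qed
qed

text \<open>The derivative is a product of two copies of \<open>inverse h\<close> and a derivative
  of \<open>h\<close>, so level \<open>k\<close> of \<open>inverse h\<close> itself supplies level
  \<open>k + 1\<close>.\<close>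

lemma higher_differentiable_on_inverse:
  fixes h :: "'a::real_normed_vector \<Rightarrow> real"
  assumes "higher_differentiable_on UNIV h k" "\<And>x. h x \<noteq> 0"
  shows "higher_differentiable_on UNIV (\<lambda>x. inverse (h x)) k"
  using assms(1)
proof (induction k)
  case 0
  then show ?case using assms(2) by (auto intro: continuous_on_inverse)
next
  case (Suc k)
  note h = higher_differentiable_on_SucD[OF Suc.prems]
  have IH: "higher_differentiable_on UNIV (\<lambda>x. inverse (h x)) k"
    by (intro Suc.IH higher_differentiable_on_Suc_lower[OF Suc.prems])
  show ?case
    by (rule higher_differentiable_on_SucI[OF Deriv.has_derivative_inverse[OF assms(2) h(1)]])
      (rule higher_differentiable_on_linear_comp[OF bounded_linear_minus[OF bounded_linear_ident]],
       rule higher_differentiable_on_mult[OF higher_differentiable_on_mult[OF IH h(2)] IH])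
qed

lemma smooth_onI: "(\<And>k. higher_differentiable_on S f k) \<Longrightarrow> smooth_on S f"
  and smooth_onD: "smooth_on S f \<Longrightarrow> higher_differentiable_on S f k"
  by (auto simp: smooth_on_def)

lemma smooth_on_const: "smooth_on UNIV (\<lambda>x. c)"
  by (rule smooth_onI, intro higher_differentiable_on_const)

lemma smooth_on_bounded_linear: "bounded_linear L \<Longrightarrow> smooth_on UNIV L"
  by (rule smooth_onI, intro higher_differentiable_on_bounded_linear)

lemma smooth_on_add: "smooth_on UNIV f \<Longrightarrow> smooth_on UNIV g \<Longrightarrow> smooth_on UNIV (\<lambda>x. f x + g x)"
  by (rule smooth_onI, intro higher_differentiable_on_add smooth_onD)

lemma smooth_on_scaleR:
  "smooth_on UNIV f \<Longrightarrow> smooth_on UNIV g \<Longrightarrow> smooth_on UNIV (\<lambda>x. f x *\<^sub>R g x)"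
  by (rule smooth_onI, intro higher_differentiable_on_scaleR smooth_onD)

lemma smooth_on_mult:
  fixes f g :: "'a::real_normed_vector \<Rightarrow> real"
  shows "smooth_on UNIV f \<Longrightarrow> smooth_on UNIV g \<Longrightarrow> smooth_on UNIV (\<lambda>x. f x * g x)"
  by (rule smooth_onI, intro higher_differentiable_on_mult smooth_onD)

lemma smooth_on_diff:
  fixes f g :: "'a::real_normed_vector \<Rightarrow> 'b::real_normed_vector"
  assumes "smooth_on UNIV f" "smooth_on UNIV g"
  shows "smooth_on UNIV (\<lambda>x. f x - g x)"
  using smooth_on_add[OF assms(1) smooth_on_scaleR[OF smooth_on_const[of "-1::real"] assms(2)]]
  by simp

lemma smooth_on_compose:
  fixes f :: "'b::euclidean_space \<Rightarrow> 'c::real_normed_vector"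
  shows "smooth_on UNIV f \<Longrightarrow> smooth_on UNIV g \<Longrightarrow> smooth_on UNIV (\<lambda>x. f (g x))"
  by (rule smooth_onI, rule higher_differentiable_on_compose; rule smooth_onD)

lemma smooth_on_inverse:
  fixes h :: "'a::real_normed_vector \<Rightarrow> real"
  shows "smooth_on UNIV h \<Longrightarrow> (\<And>x. h x \<noteq> 0) \<Longrightarrow> smooth_on UNIV (\<lambda>x. inverse (h x))"
  by (rule smooth_onI, intro higher_differentiable_on_inverse smooth_onD) auto

lemma smooth_on_has_derivative:
  "smooth_on UNIV f \<Longrightarrow> (f has_derivative frechet_derivative f (at x)) (at x)"
  using higher_differentiable_on_SucD(1)[OF smooth_onD] .

lemma smooth_on_derivative:
  "smooth_on UNIV f \<Longrightarrow> smooth_on UNIV (\<lambda>x. frechet_derivative f (at x) v)"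
  by (rule smooth_onI, intro higher_differentiable_on_SucD(2) smooth_onD)

lemma smooth_on_continuous: "smooth_on S f \<Longrightarrow> continuous_on S f"
  using smooth_onD[of S f 0] by simp

section \<open>Bump functions and test functions\<close>

text \<open>The family \<open>t \<mapsto> exp (-1/t) / t^m\<close>, extended by 0, is closed under differentiation up to
  linear combinations, so all its members are smooth.\<close>

definition flat_exp :: "nat \<Rightarrow> real \<Rightarrow> real" where
  "flat_exp m t = (if 0 < t then exp (- inverse t) * inverse t ^ m else 0)"

lemma flat_exp_tendsto_0: "(flat_exp m \<longlongrightarrow> 0) (at 0)"
proof -
  have "((\<lambda>s::real. s ^ m / exp s) \<longlongrightarrow> 0) at_top"
    by (rule tendsto_power_div_exp_0)
  then have "((\<lambda>t::real. inverse t ^ m / exp (inverse t)) \<longlongrightarrow> 0) (at_right 0)"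
    by (rule filterlim_compose[OF _ filterlim_inverse_at_top_right])
  then have "(flat_exp m \<longlongrightarrow> 0) (at_right 0)"
    by (rule Lim_transform_eventually)
      (auto simp: flat_exp_def eventually_at_filter exp_minus field_simps)
  moreover have "(flat_exp m \<longlongrightarrow> 0) (at_left 0)"
    by (rule Lim_transform_eventually[OF tendsto_const])
      (auto simp: flat_exp_def eventually_at_filter)
  ultimately show ?thesis
    by (simp add: filterlim_at_split)
qed

lemma flat_exp_has_derivative:
  "(flat_exp m has_derivative (*) (flat_exp (m + 2) t + (- real m) * flat_exp (m + 1) t)) (at t)"
proof -
  consider "t > 0" | "t < 0" | "t = 0" by linarith
  then show ?thesis
  proof cases
    case 1
    have "((\<lambda>t. exp (- inverse t) * inverse t ^ m) has_real_derivative
        (flat_exp (m + 2) t + (- real m) * flat_exp (m + 1) t)) (at t)"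
      using 1
      by (auto intro!: derivative_eq_intros simp: flat_exp_def field_simps power2_eq_square)
         (cases m; simp add: field_simps)
    then have "(flat_exp m has_real_derivative
        (flat_exp (m + 2) t + (- real m) * flat_exp (m + 1) t)) (at t)"
      by (rule DERIV_cong_ev[THEN iffD1, rotated -1])
        (use 1 eventually_nhds_in_open[of "{0<..}" t] in \<open>auto simp: flat_exp_def elim: eventually_mono\<close>)
    then show ?thesis
      by (simp add: has_field_derivative_def)
  next
    case 2
    have "((\<lambda>t. 0) has_real_derivative
        (flat_exp (m + 2) t + (- real m) * flat_exp (m + 1) t)) (at t)"
      using 2 by (simp add: flat_exp_def)
    then have "(flat_exp m has_real_derivative
        (flat_exp (m + 2) t + (- real m) * flat_exp (m + 1) t)) (at t)"
      by (rule DERIV_cong_ev[THEN iffD1, rotated -1])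
        (use 2 eventually_nhds_in_open[of "{..<0}" t] in \<open>auto simp: flat_exp_def elim: eventually_mono\<close>)
    then show ?thesis
      by (simp add: has_field_derivative_def)
  next
    case 3
    \<comment> \<open>Dividing by \<open>h\<close> raises the exponent by one: the difference
      quotient at 0 is \<open>flat_exp (Suc m)\<close>.\<close>
    have "((\<lambda>h. (flat_exp m (0 + h) - flat_exp m 0) / h) \<longlongrightarrow> 0) (at 0)"
      by (rule Lim_transform_eventually[OF flat_exp_tendsto_0[of "Suc m"]])
        (auto simp: flat_exp_def eventually_at_filter field_simps)
    then have "(flat_exp m has_real_derivative 0) (at 0)"
      by (simp add: DERIV_def)
    then show ?thesis
      using 3 by (simp add: has_field_derivative_def flat_exp_def)
  qed
qed

lemma smooth_flat_exp: "smooth_on UNIV (flat_exp m)"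
proof (rule smooth_onI)
  show "higher_differentiable_on UNIV (flat_exp m) k" for k
  proof (induction k arbitrary: m)
    case 0
    show ?case
      using flat_exp_has_derivative
      by (auto intro!: continuous_at_imp_continuous_on has_derivative_continuous)
  next
    case (Suc k)
    show ?case
      by (rule higher_differentiable_on_SucI[OF flat_exp_has_derivative])
        (intro higher_differentiable_on_mult higher_differentiable_on_add
          higher_differentiable_on_const Suc)
  qed
qed

lemma smooth_bump_exists:
  obtains \<eta> :: "'a::euclidean_space \<Rightarrow> real" where "smooth_on UNIV \<eta>"
    "\<And>x. 0 \<le> \<eta> x" "\<And>x. \<eta> x \<le> 1"
    "\<And>x. norm x \<le> 1 \<Longrightarrow> \<eta> x = 1" "\<And>x. 2 \<le> norm x \<Longrightarrow> \<eta> x = 0"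
proof
  define h where "h = flat_exp 0"
  have h: "smooth_on UNIV h" "\<And>t. 0 \<le> h t" "\<And>t. 0 < t \<Longrightarrow> 0 < h t" "\<And>t. t \<le> 0 \<Longrightarrow> h t = 0"
    using smooth_flat_exp by (auto simp: h_def flat_exp_def)
  \<comment> \<open>One of \<open>2 - q\<close> and \<open>q - 1\<close> is always positive, so
    \<open>D\<close> never vanishes and h(2 - q) / D(q) is smooth. It is evaluated at
    \<open>q = x \<bullet> x\<close> because the norm itself is not differentiable at 0.\<close>
  define D where "D = (\<lambda>q. h (2 - q) + h (q - 1))"
  have D: "D q > 0" for q
    using h(2)[of "2 - q"] h(2)[of "q - 1"] h(3)[of "2 - q"] h(3)[of "q - 1"]
    unfolding D_def by (cases "q < 2") (auto simp: add_pos_nonneg add_nonneg_pos)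
  let ?\<eta> = "\<lambda>x::'a. h (2 - x \<bullet> x) * inverse (D (x \<bullet> x))"
  have q: "smooth_on UNIV (\<lambda>x::'a. x \<bullet> x)"
    using bounded_bilinear.higher_differentiable_on_prod[OF bounded_bilinear_inner
      higher_differentiable_on_bounded_linear[OF bounded_linear_ident]
      higher_differentiable_on_bounded_linear[OF bounded_linear_ident]]
    by (auto intro: smooth_onI)
  have id: "smooth_on UNIV (\<lambda>x::real. x)"
    by (intro smooth_on_bounded_linear bounded_linear_ident)
  have sD: "smooth_on UNIV D"
    unfolding D_def
    by (intro smooth_on_add smooth_on_compose[OF h(1) smooth_on_diff[OF smooth_on_const id]]
        smooth_on_compose[OF h(1) smooth_on_diff[OF id smooth_on_const]])
  have D0: "D q \<noteq> 0" for q
    using D[of q] by simp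
  show "smooth_on UNIV ?\<eta>"
    by (rule smooth_on_mult[OF smooth_on_compose[OF h(1) smooth_on_diff[OF smooth_on_const q]]
        smooth_on_inverse[OF smooth_on_compose[OF sD q] D0]])
  show "0 \<le> ?\<eta> x" for x using h(2) D[of "x \<bullet> x"] by auto
  show "?\<eta> x \<le> 1" for x using h(2)[of "x \<bullet> x - 1"] D[of "x \<bullet> x"]
    by (simp add: field_simps) (simp add: D_def)
  show "?\<eta> x = 1" if "norm x \<le> 1" for x
  proof -
    have "x \<bullet> x \<le> 1" using that power_le_one[of "norm x" 2] by (simp add: power2_norm_eq_inner)
    then show ?thesis using h(4)[of "x \<bullet> x - 1"] h(3)[of "2 - x \<bullet> x"] by (simp add: D_def)
  qed
  show "?\<eta> x = 0" if "2 \<le> norm x" for x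
  proof -
    have "x \<bullet> x \<ge> 2" using power_mono[OF that, of 2] by (simp add: power2_norm_eq_inner)
    then show ?thesis using h(4)[of "2 - x \<bullet> x"] by simp
  qed
qed

section \<open>Test functions: closure under derivatives and uniform estimates\<close>

lemma test_functionsI: "smooth_on UNIV f \<Longrightarrow> bounded {x. f x \<noteq> 0} \<Longrightarrow> f \<in> test_functions"
  and test_functionsD: "f \<in> test_functions \<Longrightarrow> smooth_on UNIV f"
    "f \<in> test_functions \<Longrightarrow> bounded {x. f x \<noteq> 0}"
  by (auto simp: test_functions_def)

text \<open>A locally vanishing function has vanishing derivative, so the support does not grow.
  This closure lets uniform bounds for test functions apply to their derivatives of every
  order.\<close>

lemma test_functions_derivative:
  assumes "f \<in> test_functions"
  shows "(\<lambda>x. frechet_derivative f (at x) v) \<in> test_functions"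
proof (intro test_functionsI smooth_on_derivative test_functionsD(1)[OF assms])
  have "frechet_derivative f (at x) v = 0" if "x \<notin> closure {x. f x \<noteq> 0}" for x
  proof -
    have "(f has_derivative (\<lambda>_. 0)) (at x)"
    proof (rule has_derivative_transform_within_open[OF has_derivative_const[of 0]])
      show "x \<in> - closure {x. f x \<noteq> 0}" using that by simp
      show "0 = f y" if "y \<in> - closure {x. f x \<noteq> 0}" for y
        using that closure_subset[of "{x. f x \<noteq> 0}"] by auto
    qed auto
    then show ?thesis by (simp add: frechet_derivative_at[symmetric])
  qed
  then have "{x. frechet_derivative f (at x) v \<noteq> 0} \<subseteq> closure {x. f x \<noteq> 0}" by blast
  then show "bounded {x. frechet_derivative f (at x) v \<noteq> 0}"
    using bounded_subset bounded_closure test_functionsD(2)[OF assms] by blast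
qed

lemma test_functions_bounded:
  assumes "f \<in> test_functions"
  obtains M where "0 \<le> M" "\<And>x. \<bar>f x\<bar> \<le> M"
proof -
  let ?S = "closure {x. f x \<noteq> 0}"
  have "compact (f ` ?S)"
    using assms by (intro compact_continuous_image continuous_on_subset[OF smooth_on_continuous])
      (auto simp: test_functions_def)
  then obtain B where B: "\<And>y. y \<in> f ` ?S \<Longrightarrow> \<bar>y\<bar> \<le> B"
    using compact_imp_bounded bounded_iff by (metis real_norm_def)
  have "\<bar>f x\<bar> \<le> max 0 B" for x
    using B[of "f x"] closure_subset[of "{x. f x \<noteq> 0}"] by (cases "f x = 0") (force simp: max_def)+
  then show ?thesis using that[of "max 0 B"] by auto
qed

lemma abs_linear_le_sum_Basis:
  fixes L :: "'a::euclidean_space \<Rightarrow> real"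
  assumes "linear L" "\<And>b. b \<in> Basis \<Longrightarrow> \<bar>L b\<bar> \<le> M b"
  shows "\<bar>L v\<bar> \<le> (\<Sum>b\<in>Basis. M b) * norm v"
proof -
  have "L v = (\<Sum>b\<in>Basis. (v \<bullet> b) * L b)"
    by (subst euclidean_representation[symmetric, of v])
      (simp only: linear_sum[OF assms(1)] linear_scale[OF assms(1)] real_scaleR_def)
  also have "\<bar>\<dots>\<bar> \<le> (\<Sum>b\<in>Basis. norm v * M b)"
    by (intro order.trans[OF sum_abs] sum_mono)
      (auto simp: abs_mult intro!: mult_mono assms(2) Basis_le_norm)
  finally show ?thesis by (simp add: sum_distrib_left mult.commute)
qed

lemma test_functions_Lipschitz:
  fixes f :: "'a::euclidean_space \<Rightarrow> real"
  assumes "f \<in> test_functions"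
  obtains L where "0 \<le> L" "\<And>x y. \<bar>f x - f y\<bar> \<le> L * norm (x - y)"
proof -
  have "\<forall>b. \<exists>M\<ge>0. \<forall>x. \<bar>frechet_derivative f (at x) b\<bar> \<le> M"
    by (metis test_functions_bounded[OF test_functions_derivative[OF assms]])
  then obtain M where M: "\<And>b. 0 \<le> M b" "\<And>x b. \<bar>frechet_derivative f (at x) b\<bar> \<le> M b"
    by metis
  note D = smooth_on_has_derivative[OF test_functionsD(1)[OF assms]]
  show ?thesis
  proof (rule that[of "\<Sum>b\<in>Basis. M b"])
    fix x y :: 'a
    have "onorm (frechet_derivative f (at z)) \<le> (\<Sum>b\<in>Basis. M b)" for z
      using abs_linear_le_sum_Basis[OF has_derivative_linear[OF D] M(2)]
      by (intro onorm_le) auto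
    then show "\<bar>f x - f y\<bar> \<le> (\<Sum>b\<in>Basis. M b) * norm (x - y)"
      using differentiable_bound[OF convex_UNIV D _ UNIV_I UNIV_I] by fastforce
  qed (simp add: M sum_nonneg)
qed

text \<open>The directional derivatives are Lipschitz, so on the ball of radius
  \<open>norm v\<close> around \<open>x\<close> the derivative of \<open>f\<close> minus its linear
  part at \<open>x\<close> is O(\<open>norm v\<close>); the mean value inequality gives the second
  factor. Uniformity in \<open>x\<close> is what permits differentiation under the integral
  later.\<close>

lemma test_functions_quadratic_remainder:
  fixes f :: "'a::euclidean_space \<Rightarrow> real"
  assumes "f \<in> test_functions"
  obtains C where "0 \<le> C"
    "\<And>x v. \<bar>f (x + v) - f x - frechet_derivative f (at x) v\<bar> \<le> C * norm v ^ 2"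
proof -
  let ?D = "\<lambda>x. frechet_derivative f (at x)"
  have "\<forall>b. \<exists>L\<ge>0. \<forall>x y. \<bar>?D x b - ?D y b\<bar> \<le> L * norm (x - y)"
    by (metis test_functions_Lipschitz[OF test_functions_derivative[OF assms]])
  then obtain L where L: "\<And>b. 0 \<le> L b" "\<And>x y b. \<bar>?D x b - ?D y b\<bar> \<le> L b * norm (x - y)"
    by metis
  note D = smooth_on_has_derivative[OF test_functionsD(1)[OF assms]]
  let ?C = "\<Sum>b\<in>Basis. L b"
  show ?thesis
  proof (rule that[of ?C])
    fix x v :: 'a
    let ?w = "\<lambda>z. f z - ?D x z" and ?dw = "\<lambda>z h. ?D z h - ?D x h"
    have dw: "(?w has_derivative ?dw z) (at z within S)" for z S
      by (intro has_derivative_diff has_derivative_at_withinI[OF D]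
        bounded_linear_imp_has_derivative has_derivative_bounded_linear[OF D])
    have "onorm (?dw z) \<le> ?C * norm v" if "z \<in> cball x (norm v)" for z
    proof (rule onorm_le)
      fix h
      have "linear (?dw z)" using dw has_derivative_linear by blast
      moreover have "\<bar>?dw z b\<bar> \<le> L b * norm v" for b
        using L(2)[of z b x] that L(1)[of b]
        by (intro order.trans[OF L(2)] mult_left_mono) (auto simp: dist_norm norm_minus_commute)
      ultimately show "norm (?dw z h) \<le> ?C * norm v * norm h"
        using abs_linear_le_sum_Basis[of "?dw z" "\<lambda>b. L b * norm v" h]
        by (simp add: sum_distrib_right)
    qed
    then have "norm (?w (x + v) - ?w x) \<le> ?C * norm v * norm (x + v - x)"
      by (intro differentiable_bound[OF convex_cball dw]) (auto simp: dist_norm)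
    moreover have "?D x (x + v) = ?D x x + ?D x v"
      by (rule linear_add[OF has_derivative_linear[OF D]])
    ultimately show "\<bar>f (x + v) - f x - ?D x v\<bar> \<le> ?C * norm v ^ 2"
      by (simp add: power2_eq_square algebra_simps)
  qed (simp add: L sum_nonneg)
qed

section \<open>The fractional seminorm\<close>

lemma lborel_distr_reflect: "distr lborel borel (\<lambda>x. c - x) = (lborel :: 'a::euclidean_space measure)"
  by (subst (2) lborel_affine[of "-1" c]) (auto simp: density_1)

lemma nn_integral_lborel_translate:
  assumes [measurable]: "f \<in> borel_measurable borel"
  shows "(\<integral>\<^sup>+x. f (c + x) \<partial>lborel) = (\<integral>\<^sup>+x. f x \<partial>(lborel :: 'a::euclidean_space measure))"
  by (subst (2) lborel_distr_plus[of c, symmetric]) (simp add: nn_integral_distr)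

text \<open>The integrand is the indicator of the interval between \<open>a\<close> and
  \<open>b\<close>. Since \<open>t\<close> runs over all reals, values of either sign are
  covered.\<close>

lemma nn_integral_abs_diff_indicator:
  fixes a b :: real
  shows "(\<integral>\<^sup>+t. ennreal \<bar>(if t < a then 1 else 0) - (if t < b then 1 else 0)\<bar> \<partial>lborel) = ennreal \<bar>a - b\<bar>"
proof -
  have "ennreal \<bar>(if t < a then 1 else 0) - (if t < b then 1 else 0)\<bar> = indicator {min a b..<max a b} t" for t
    by (auto simp: indicator_def min_def max_def)
  then have "(\<integral>\<^sup>+t. ennreal \<bar>(if t < a then 1 else 0) - (if t < b then 1 else 0)\<bar> \<partial>lborel) =
      emeasure lborel {min a b..<max a b}"
    by simp
  also have "\<dots> = ennreal \<bar>a - b\<bar>"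
    by (simp add: min_def max_def abs_if)
  finally show ?thesis .
qed

text \<open>Each increment of \<open>f\<close> is an integral over thresholds of increments of
  indicators; Tonelli moves that integral outside \<open>x\<close> and then outside
  \<open>h\<close>. Borel generality matters, since the formula is applied to a function with a
  Lipschitz cutoff.\<close>

lemma frac_sobolev_norm_coarea:
  fixes f :: "'a::euclidean_space \<Rightarrow> real"
  assumes [measurable]: "f \<in> borel_measurable borel"
  shows "frac_sobolev_norm \<alpha> f = (\<integral>\<^sup>+t. frac_sobolev_norm \<alpha> (indicator {x. t < f x}) \<partial>lborel)"
proof -
  let ?I = "\<lambda>t x h. ennreal \<bar>(if t < f (x + h) then 1 else 0) - (if t < f x then 1 else 0 :: real)\<bar>"
  let ?k = "\<lambda>h::'a. ennreal (norm h powr (real DIM('a) + \<alpha>))"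
  have "frac_sobolev_norm \<alpha> f = (\<integral>\<^sup>+h. (\<integral>\<^sup>+x. (\<integral>\<^sup>+t. ?I t x h \<partial>lborel) \<partial>lborel) / ?k h \<partial>lborel)"
    by (simp only: frac_sobolev_norm_def nn_integral_abs_diff_indicator)
  also have "\<dots> = (\<integral>\<^sup>+h. (\<integral>\<^sup>+t. (\<integral>\<^sup>+x. ?I t x h \<partial>lborel) \<partial>lborel) / ?k h \<partial>lborel)"
    by (subst lborel_pair.Fubini') simp_all
  also have "\<dots> = (\<integral>\<^sup>+h. (\<integral>\<^sup>+t. (\<integral>\<^sup>+x. ?I t x h \<partial>lborel) / ?k h \<partial>lborel) \<partial>lborel)"
    by (subst nn_integral_divide) simp_all
  also have "\<dots> = (\<integral>\<^sup>+t. (\<integral>\<^sup>+h. (\<integral>\<^sup>+x. ?I t x h \<partial>lborel) / ?k h \<partial>lborel) \<partial>lborel)"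
    by (subst lborel_pair.Fubini') simp_all
  finally show ?thesis
    by (simp add: frac_sobolev_norm_def indicator_def of_bool_def)
qed

lemma frac_sobolev_norm_indicator:
  fixes E :: "'a::euclidean_space set"
  assumes [measurable]: "E \<in> sets borel"
  shows "frac_sobolev_norm \<alpha> (indicator E) = 2 * frac_perimeter \<alpha> E"
proof -
  let ?p = "real DIM('a) + \<alpha>"
  let ?A = "\<lambda>x y. ennreal \<bar>indicator E y - indicator E x\<bar> / ennreal (norm (y - x) powr ?p)"
  let ?K = "\<lambda>x y::'a. ennreal (1 / norm (x - y) powr ?p)"
  \<comment> \<open>On the diagonal the real quotient is 0 and the \<open>ennreal\<close> quotient
    is infinite, so the two kernels agree only for \<open>x \<noteq> y\<close>. In \<open>A\<close>
    this is harmless: at \<open>x = y\<close> the indicator difference and both indicator products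
    vanish.\<close>
  have "1 / ennreal (norm (y - x) powr ?p) = ?K x y" if "x \<noteq> y" for x y :: 'a
    using divide_ennreal[of 1 "norm (y - x) powr ?p"] that by (simp add: norm_minus_commute)
  then have A: "?A x y = ?K x y * indicator (- E) y * indicator E x + ?K y x * indicator (- E) x * indicator E y"
    for x y
    by (cases "x \<in> E"; cases "y \<in> E"; cases "x = y")
      (auto simp: norm_minus_commute)
  have "frac_sobolev_norm \<alpha> (indicator E) = (\<integral>\<^sup>+h. (\<integral>\<^sup>+x. ?A x (x + h) \<partial>lborel) \<partial>lborel)"
    unfolding frac_sobolev_norm_def by (simp add: nn_integral_divide)
  also have "\<dots> = (\<integral>\<^sup>+x. (\<integral>\<^sup>+h. ?A x (x + h) \<partial>lborel) \<partial>lborel)"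
    by (subst lborel_pair.Fubini') simp_all
  also have "\<dots> = (\<integral>\<^sup>+x. (\<integral>\<^sup>+y. ?A x y \<partial>lborel) \<partial>lborel)"
    by (subst nn_integral_lborel_translate) simp_all
  also have "\<dots> = (\<integral>\<^sup>+x. (\<integral>\<^sup>+y. ?K x y * indicator (- E) y * indicator E x \<partial>lborel) \<partial>lborel) +
      (\<integral>\<^sup>+x. (\<integral>\<^sup>+y. ?K y x * indicator (- E) x * indicator E y \<partial>lborel) \<partial>lborel)"
    unfolding A by (simp add: nn_integral_add)
  also have "(\<integral>\<^sup>+x. (\<integral>\<^sup>+y. ?K y x * indicator (- E) x * indicator E y \<partial>lborel) \<partial>lborel) =
      (\<integral>\<^sup>+x. (\<integral>\<^sup>+y. ?K x y * indicator (- E) y * indicator E x \<partial>lborel) \<partial>lborel)"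
    by (rule lborel_pair.Fubini') simp
  also have "(\<integral>\<^sup>+x. (\<integral>\<^sup>+y. ?K x y * indicator (- E) y * indicator E x \<partial>lborel) \<partial>lborel) = frac_perimeter \<alpha> E"
    unfolding frac_perimeter_def by (simp add: nn_integral_multc)
  finally show ?thesis by (simp add: mult_2)
qed

lemma frac_sobolev_norm_add_le:
  fixes f g :: "'a::euclidean_space \<Rightarrow> real"
  assumes [measurable]: "f \<in> borel_measurable borel" "g \<in> borel_measurable borel"
  shows "frac_sobolev_norm \<alpha> (\<lambda>x. f x + g x) \<le> frac_sobolev_norm \<alpha> f + frac_sobolev_norm \<alpha> g"
proof -
  let ?k = "\<lambda>h::'a. ennreal (norm h powr (real DIM('a) + \<alpha>))"
  have "frac_sobolev_norm \<alpha> (\<lambda>x. f x + g x) \<le>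
      (\<integral>\<^sup>+h. (\<integral>\<^sup>+x. ennreal \<bar>f (x + h) - f x\<bar> + ennreal \<bar>g (x + h) - g x\<bar> \<partial>lborel) / ?k h \<partial>lborel)"
    unfolding frac_sobolev_norm_def
    by (intro nn_integral_mono divide_right_mono_ennreal) (simp flip: ennreal_plus)
  also have "\<dots> = frac_sobolev_norm \<alpha> f + frac_sobolev_norm \<alpha> g"
    unfolding frac_sobolev_norm_def
    by (simp add: nn_integral_add add_divide_distrib_ennreal)
  finally show ?thesis .
qed

text \<open>For fixed \<open>h\<close>, the increment of the convolution is the \<rho>-average of
  translated increments of the indicator. By translation invariance all of these have the same L1
  norm, and the total mass is 1, so the bound holds before the weight in \<open>h\<close>
  enters.\<close>

lemma frac_sobolev_norm_convolution_le:
  fixes E :: "'a::euclidean_space set" and \<rho> :: "'a \<Rightarrow> real"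
  assumes [measurable]: "E \<in> sets borel" and \<rho>: "integrable lborel \<rho>" "\<And>x. 0 \<le> \<rho> x"
    and mass: "integral\<^sup>L lborel \<rho> = 1"
  shows "frac_sobolev_norm \<alpha> (\<lambda>x. LINT z|lborel. \<rho> z * indicator E (x - z)) \<le> frac_sobolev_norm \<alpha> (indicator E)"
proof -
  let ?F = "\<lambda>x. LINT z|lborel. \<rho> z * indicator E (x - z)"
  let ?k = "\<lambda>h::'a. ennreal (norm h powr (real DIM('a) + \<alpha>))"
  let ?A = "\<lambda>x h. ennreal \<bar>indicator E (x + h) - indicator E x\<bar>"
  have [measurable]: "\<rho> \<in> borel_measurable borel" using \<rho>(1) by simp
  have int: "integrable lborel (\<lambda>z. \<rho> z * indicator E (x - z))" for x
    by (rule Bochner_Integration.integrable_bound[OF \<rho>(1)]) (auto simp: indicator_def)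
  have F: "ennreal \<bar>?F (x + h) - ?F x\<bar> \<le> (\<integral>\<^sup>+z. ennreal (\<rho> z) * ?A (- z + x) h \<partial>lborel)" for x h
  proof -
    have "?F (x + h) - ?F x = (LINT z|lborel. \<rho> z * indicator E (x + h - z) - \<rho> z * indicator E (x - z))"
      by (rule Bochner_Integration.integral_diff[symmetric]) (rule int)+
    also have "ennreal \<bar>\<dots>\<bar> \<le> (\<integral>\<^sup>+z. ennreal \<bar>\<rho> z * indicator E (x + h - z) - \<rho> z * indicator E (x - z)\<bar> \<partial>lborel)"
      using integral_norm_bound_ennreal[OF Bochner_Integration.integrable_diff[OF int int]] by simp
    also have "\<dots> = (\<integral>\<^sup>+z. ennreal (\<rho> z) * ?A (- z + x) h \<partial>lborel)"
    proof (rule nn_integral_cong)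
      fix z
      have *: "x + h - z = - z + x + h" "x - z = - z + x" by simp_all
      show "ennreal \<bar>\<rho> z * indicator E (x + h - z) - \<rho> z * indicator E (x - z)\<bar> = ennreal (\<rho> z) * ?A (- z + x) h"
        unfolding * right_diff_distrib[symmetric] abs_mult using \<rho>(2)[of z] by (simp add: ennreal_mult)
    qed
    finally show ?thesis .
  qed
  have inner: "(\<integral>\<^sup>+x. ennreal \<bar>?F (x + h) - ?F x\<bar> \<partial>lborel) \<le> (\<integral>\<^sup>+x. ?A x h \<partial>lborel)" for h
  proof -
    have "(\<integral>\<^sup>+x. ennreal \<bar>?F (x + h) - ?F x\<bar> \<partial>lborel) \<le>
        (\<integral>\<^sup>+x. (\<integral>\<^sup>+z. ennreal (\<rho> z) * ?A (- z + x) h \<partial>lborel) \<partial>lborel)"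
      by (intro nn_integral_mono F)
    also have "\<dots> = (\<integral>\<^sup>+z. (\<integral>\<^sup>+x. ennreal (\<rho> z) * ?A (- z + x) h \<partial>lborel) \<partial>lborel)"
      by (rule lborel_pair.Fubini') simp
    also have "\<dots> = (\<integral>\<^sup>+z. ennreal (\<rho> z) * (\<integral>\<^sup>+x. ?A x h \<partial>lborel) \<partial>lborel)"
      by (subst nn_integral_cmult, simp, subst nn_integral_lborel_translate) simp_all
    also have "\<dots> = (\<integral>\<^sup>+x. ?A x h \<partial>lborel)"
      using nn_integral_eq_integral[OF \<rho>(1)] \<rho>(2) mass by (simp add: nn_integral_multc)
    finally show ?thesis .
  qed
  show ?thesis
    unfolding frac_sobolev_norm_def by (intro nn_integral_mono[OF divide_right_mono_ennreal[OF inner]])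
qed

text \<open>With n the dimension, the integrand is |h|^(1 - n - \<alpha>) near 0, integrable since
  \<alpha> < 1, and |h|^(- n - \<alpha>) at infinity, integrable since \<alpha> > 0. A dyadic
  decomposition reduces both claims to geometric series.\<close>

lemma nn_integral_frac_kernel_finite:
  assumes "0 < \<alpha>" "\<alpha> < 1"
  shows "(\<integral>\<^sup>+h. ennreal (min 1 (norm h) / norm h powr (real DIM('a) + \<alpha>)) \<partial>(lborel :: 'a::euclidean_space measure)) < \<infinity>"
proof -
  let ?n = "real DIM('a)"
  let ?p = "?n + \<alpha>"
  let ?V = "unit_ball_vol ?n"
  have "1 \<le> ?n" using DIM_positive[where 'a='a] by linarith
  then have p: "1 \<le> ?p" using assms by linarith
  \<comment> \<open>\<open>a k\<close> bounds the integrand for 2^(-k-1) < |h| \<le> 2^(-k), and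
    \<open>b k\<close> bounds it for 2^k \<le> |h| < 2^(k+1). Enlarging each shell to the full ball
    costs only a constant factor: the resulting series have ratios 2^(\<alpha> - 1) and
    2^(-\<alpha>).\<close>
  define a b where "a k = 2 powr ((real k + 1) * (?p - 1))" and "b k = 2 powr (- real k * ?p)" for k
  define A B :: "nat \<Rightarrow> 'a set" where "A k = cball 0 (2 powr (- real k))" and "B k = cball 0 (2 powr (real k + 1))" for k
  define S where "S h = (\<Sum>k. ennreal (a k) * indicator (A k) h) + (\<Sum>k. ennreal (b k) * indicator (B k) h)" for h
  have A[measurable]: "A k \<in> sets borel" and B[measurable]: "B k \<in> sets borel" for k
    by (auto simp: A_def B_def)
  have a_nonneg: "0 \<le> a k" and b_nonneg: "0 \<le> b k" for k
    by (simp_all add: a_def b_def)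
  have le_suminf: "f k \<le> (\<Sum>k. f k)" for f :: "nat \<Rightarrow> ennreal" and k
    using sum_le_suminf[of f "{k}"] by simp
  have bound: "ennreal (min 1 (norm h) / norm h powr ?p) \<le> S h" for h :: 'a
  proof (cases "h = 0")
    case False
    define l where "l = log 2 (norm h)"
    have h: "norm h = 2 powr l" using False by (simp add: l_def)
    show ?thesis
    proof (cases "l \<le> 0")
      case True
      define k where "k = nat \<lfloor>- l\<rfloor>"
      have k: "real k \<le> - l" "- l < real k + 1" using True by (simp_all add: k_def)
      have "min 1 (norm h) / norm h powr ?p = 2 powr (- l * (?p - 1))"
      proof -
        have "2 powr l \<le> 1" using powr_mono[OF True, of 2] by simp
        then show ?thesis by (simp add: h powr_powr powr_diff[symmetric] algebra_simps)
      qed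
      also have "\<dots> \<le> a k"
        unfolding a_def using k p by (intro powr_mono mult_right_mono) auto
      finally have "ennreal (min 1 (norm h) / norm h powr ?p) \<le> ennreal (a k) * indicator (A k) h"
        using k h by (simp add: A_def indicator_def ennreal_leI)
      also have "\<dots> \<le> S h"
        unfolding S_def using le_suminf[of "\<lambda>k. ennreal (a k) * indicator (A k) h" k] by (simp add: add_increasing2)
      finally show ?thesis .
    next
      case False
      define k where "k = nat \<lfloor>l\<rfloor>"
      have k: "real k \<le> l" "l < real k + 1" using False by (simp_all add: k_def)
      have "1 \<le> norm h" using False by (simp add: h ge_one_powr_ge_zero)
      then have "min 1 (norm h) / norm h powr ?p = 2 powr (- l * ?p)"
        by (simp add: h powr_powr powr_minus_divide)
      also have "\<dots> \<le> b k"
        unfolding b_def using k p by (intro powr_mono mult_right_mono) auto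
      finally have "ennreal (min 1 (norm h) / norm h powr ?p) \<le> ennreal (b k) * indicator (B k) h"
        using k h by (simp add: B_def indicator_def ennreal_leI)
      also have "\<dots> \<le> S h"
        unfolding S_def using le_suminf[of "\<lambda>k. ennreal (b k) * indicator (B k) h" k] by (simp add: add_increasing)
      finally show ?thesis .
    qed
  qed simp
  have geom: "(\<Sum>k. ennreal (c * q ^ k)) < \<infinity>" if "0 \<le> c" "0 \<le> q" "q < 1" for c q :: real
    using that by (subst suminf_ennreal2) (auto intro!: summable_mult summable_geometric)
  have meas: "ennreal c * emeasure lborel (cball (0::'a) r) = ennreal (?V * (c * r ^ DIM('a)))"
    if "0 \<le> c" "0 \<le> r" for c r
    using that by (simp add: emeasure_cball ennreal_mult[symmetric] mult.left_commute)
  have "a k * (2 powr (- real k)) ^ DIM('a) = 2 powr (?p - 1) * (2 powr (\<alpha> - 1)) ^ k" for k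
    unfolding a_def by (simp add: powr_power flip: powr_add) (simp add: algebra_simps)
  then have eA: "ennreal (a k) * emeasure lborel (A k) = ennreal ((?V * 2 powr (?p - 1)) * (2 powr (\<alpha> - 1)) ^ k)" for k
    unfolding A_def by (subst meas) (simp_all add: mult.assoc a_nonneg)
  have "b k * (2 powr (real k + 1)) ^ DIM('a) = 2 powr ?n * (2 powr (- \<alpha>)) ^ k" for k
    unfolding b_def by (simp add: powr_power flip: powr_add) (simp add: algebra_simps)
  then have eB: "ennreal (b k) * emeasure lborel (B k) = ennreal ((?V * 2 powr ?n) * (2 powr (- \<alpha>)) ^ k)" for k
    unfolding B_def by (subst meas) (simp_all add: mult.assoc b_nonneg)
  have q: "2 powr (\<alpha> - 1) < 1" "2 powr (- \<alpha>) < (1::real)"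
    using assms powr_less_mono[of "\<alpha> - 1" 0 2] powr_less_mono[of "- \<alpha>" 0 2] by simp_all
  have "(\<integral>\<^sup>+h. S h \<partial>lborel) =
      (\<Sum>k. ennreal (a k) * emeasure lborel (A k)) + (\<Sum>k. ennreal (b k) * emeasure lborel (B k))"
    unfolding S_def by (simp add: nn_integral_add nn_integral_suminf nn_integral_cmult)
  also have "\<dots> < \<infinity>"
    unfolding eA eB infinity_ennreal_def ennreal_add_less_top
    by (intro conjI geom[unfolded infinity_ennreal_def] q) simp_all
  finally have "(\<integral>\<^sup>+h. S h \<partial>lborel) < \<infinity>" .
  then show ?thesis
    using nn_integral_mono[of lborel _ S, OF bound] by (rule le_less_trans[rotated])
qed

text \<open>An increment vanishes unless \<open>x\<close> or \<open>x + h\<close> lies in the ball,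
  so its integral over \<open>x\<close> is at most twice the volume times
  \<open>L * min 1 (norm h)\<close>. The order of quantifiers is the point: \<open>C\<close> is
  fixed before \<open>g\<close> and \<open>L\<close>, so the seminorm tends to 0 with
  \<open>L\<close>.\<close>

lemma frac_sobolev_norm_Lipschitz_le:
  fixes R :: real
  assumes "0 < \<alpha>" "\<alpha> < 1"
  obtains C where "C < \<infinity>" "\<And>(g :: 'a::euclidean_space \<Rightarrow> real) L. 0 \<le> L \<Longrightarrow> g \<in> borel_measurable borel \<Longrightarrow>
    (\<And>x. R < norm x \<Longrightarrow> g x = 0) \<Longrightarrow> (\<And>x h. \<bar>g (x + h) - g x\<bar> \<le> L * min 1 (norm h)) \<Longrightarrow>
    frac_sobolev_norm \<alpha> g \<le> ennreal L * C"
proof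
  let ?B = "cball 0 R :: 'a set"
  let ?V = "emeasure lborel ?B"
  have [measurable]: "?B \<in> sets borel" by simp
  let ?p = "real DIM('a) + \<alpha>"
  let ?I = "\<integral>\<^sup>+h. ennreal (min 1 (norm h) / norm h powr ?p) \<partial>(lborel :: 'a measure)"
  have V: "?V < \<infinity>" by (rule emeasure_bounded_finite) simp
  show "2 * ?V * ?I < \<infinity>"
    using V nn_integral_frac_kernel_finite[OF assms, where 'a='a]
    by (simp add: ennreal_mult_less_top)
  fix g :: "'a \<Rightarrow> real" and L :: real
  assume L: "0 \<le> L" and [measurable]: "g \<in> borel_measurable borel"
    and supp: "\<And>x. R < norm x \<Longrightarrow> g x = 0"
    and lip: "\<And>x h. \<bar>g (x + h) - g x\<bar> \<le> L * min 1 (norm h)"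
  have inner: "(\<integral>\<^sup>+x. ennreal \<bar>g (x + h) - g x\<bar> \<partial>lborel) \<le> ennreal (L * min 1 (norm h)) * (2 * ?V)" for h
  proof -
    have "ennreal \<bar>g (x + h) - g x\<bar> \<le> ennreal (L * min 1 (norm h)) * (indicator ?B (h + x) + indicator ?B x)" for x
    proof (cases "x \<in> ?B \<or> h + x \<in> ?B")
      case True
      then have "1 \<le> indicator ?B (h + x) + (indicator ?B x :: ennreal)"
        by (auto simp: indicator_def)
      then have "ennreal (L * min 1 (norm h)) * 1 \<le> ennreal (L * min 1 (norm h)) * (indicator ?B (h + x) + indicator ?B x)"
        by (intro mult_left_mono) auto
      then show ?thesis
        using ennreal_leI[OF lip[of x h]] by simp
    qed (simp add: supp add.commute)
    then have "(\<integral>\<^sup>+x. ennreal \<bar>g (x + h) - g x\<bar> \<partial>lborel) \<le>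
        (\<integral>\<^sup>+x. ennreal (L * min 1 (norm h)) * (indicator ?B (h + x) + indicator ?B x) \<partial>lborel)"
      by (rule nn_integral_mono)
    also have "\<dots> = ennreal (L * min 1 (norm h)) * ((\<integral>\<^sup>+x. indicator ?B (h + x) \<partial>lborel) + ?V)"
      by (simp add: nn_integral_cmult nn_integral_add)
    also have "(\<integral>\<^sup>+x. indicator ?B (h + x) \<partial>lborel) = ?V"
      by (subst nn_integral_lborel_translate) simp_all
    finally show ?thesis by (simp add: mult_2)
  qed
  have "frac_sobolev_norm \<alpha> g \<le>
      (\<integral>\<^sup>+h. (ennreal (L * min 1 (norm h)) * (2 * ?V)) / ennreal (norm h powr ?p) \<partial>(lborel :: 'a measure))"
    unfolding frac_sobolev_norm_def by (intro nn_integral_mono divide_right_mono_ennreal inner)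
  also have "\<dots> = (\<integral>\<^sup>+h. (ennreal L * (2 * ?V)) * ennreal (min 1 (norm h) / norm h powr ?p) \<partial>(lborel :: 'a measure))"
  proof (rule nn_integral_cong)
    fix h :: 'a
    show "(ennreal (L * min 1 (norm h)) * (2 * ?V)) / ennreal (norm h powr ?p) =
        (ennreal L * (2 * ?V)) * ennreal (min 1 (norm h) / norm h powr ?p)"
    proof (cases "h = 0")
      case False
      then show ?thesis
        using L by (simp add: divide_ennreal[symmetric] ennreal_mult ennreal_times_divide mult_ac)
    qed simp
  qed
  also have "\<dots> = ennreal L * (2 * ?V * ?I)"
    by (simp add: nn_integral_cmult mult_ac)
  finally show "frac_sobolev_norm \<alpha> g \<le> ennreal L * (2 * ?V * ?I)" .
qed

section \<open>Smoothness of regular level sets\<close>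

text \<open>The slope bound makes \<open>v\<close> an expanding bijection from every line parallel
  to \<open>e\<close> onto the reals, so the zero on each line exists and is unique without any
  localisation.\<close>

lemma smooth_global_implicit_function:
  fixes v :: "'a::euclidean_space \<Rightarrow> real"
  assumes v: "smooth_on UNIV v" and c: "0 < c"
    and slope: "\<And>x. c \<le> frechet_derivative v (at x) e"
  obtains g where "smooth_on UNIV g" "\<And>x y. 0 < v (x + y *\<^sub>R e) \<longleftrightarrow> g x < y"
proof -
  let ?D = "\<lambda>x. frechet_derivative v (at x)"
  note D = smooth_on_has_derivative[OF v]
  have line: "((\<lambda>y. v (x + y *\<^sub>R e)) has_real_derivative ?D (x + y *\<^sub>R e) e) (at y)" for x y
  proof -
    have "((\<lambda>y. x + y *\<^sub>R e) has_derivative (\<lambda>h. h *\<^sub>R e)) (at y)"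
      by (auto intro!: derivative_eq_intros)
    then have "((\<lambda>y. v (x + y *\<^sub>R e)) has_derivative (\<lambda>h. ?D (x + y *\<^sub>R e) (h *\<^sub>R e))) (at y)"
      using has_derivative_compose D by fast
    then show ?thesis
      by (simp add: has_field_derivative_def linear_scale[OF has_derivative_linear[OF D]]
        mult_commute_abs)
  qed
  have mono: "c * (y2 - y1) \<le> v (x + y2 *\<^sub>R e) - v (x + y1 *\<^sub>R e)" if "y1 \<le> y2" for x y1 y2
  proof -
    have "v (x + y1 *\<^sub>R e) - c * y1 \<le> v (x + y2 *\<^sub>R e) - c * y2"
    proof (rule DERIV_nonneg_imp_nondecreasing[OF that], intro exI conjI)
      show "((\<lambda>y. v (x + y *\<^sub>R e) - c * y) has_real_derivative ?D (x + z *\<^sub>R e) e - c) (at z)" for z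
        by (rule DERIV_diff[OF line DERIV_cmult_Id])
      show "0 \<le> ?D (x + z *\<^sub>R e) e - c" for z
        using slope by simp
    qed
    then show ?thesis by (simp add: algebra_simps)
  qed
  \<comment> \<open>Expansion by \<open>c\<close> means that the inverse along a line is Lipschitz
    with constant \<open>1 / c\<close>; this yields the continuity of \<gamma> needed below.\<close>
  have expand: "c * \<bar>y2 - y1\<bar> \<le> \<bar>v (x + y2 *\<^sub>R e) - v (x + y1 *\<^sub>R e)\<bar>" for x y1 y2
    using mono[of y1 y2 x] mono[of y2 y1 x] by (cases "y1 \<le> y2") auto
  have "\<exists>y. v (x + y *\<^sub>R e) = z" for x z
  proof -
    define A where "A = \<bar>z - v x\<bar> / c"
    have A: "0 \<le> A" "c * A = \<bar>z - v x\<bar>" using c by (auto simp: A_def)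
    have "\<exists>y. - A \<le> y \<and> y \<le> A \<and> v (x + y *\<^sub>R e) = z"
    proof (rule IVT')
      show "v (x + (- A) *\<^sub>R e) \<le> z" using mono[of "-A" 0 x] A by auto
      show "z \<le> v (x + A *\<^sub>R e)" using mono[of 0 A x] A by auto
      show "continuous_on {- A..A} (\<lambda>y. v (x + y *\<^sub>R e))"
        using line by (auto intro!: continuous_at_imp_continuous_on DERIV_isCont)
    qed (use A in auto)
    then show ?thesis by blast
  qed
  then obtain \<gamma> where \<gamma>: "\<And>x z. v (x + \<gamma> x z *\<^sub>R e) = z" by metis
  define g where "g x = \<gamma> x 0" for x
  have g0: "v (x + g x *\<^sub>R e) = 0" for x by (simp add: g_def \<gamma>)
  have pos: "0 < v (x + y *\<^sub>R e) \<longleftrightarrow> g x < y" for x y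
  proof
    show "g x < y" if "0 < v (x + y *\<^sub>R e)"
      using mono[of y "g x" x] that g0[of x] c by (smt (verit) mult_nonneg_nonneg)
    show "0 < v (x + y *\<^sub>R e)" if "g x < y"
      using mono[of "g x" y x] that g0[of x] c by (smt (verit) mult_pos_pos)
  qed
  have Dg: "(g has_derivative (\<lambda>h. - ?D (x + g x *\<^sub>R e) h * inverse (?D (x + g x *\<^sub>R e) e))) (at x)" for x
  proof -
    \<comment> \<open>Differentiability of \<open>g\<close> comes from the inverse function rule for
      the shear \<open>?T\<close>, which keeps the first component and replaces the second by the
      value of \<open>v\<close>. Its right inverse \<open>?S\<close> contains \<open>g\<close> as
      the slice at second component 0.\<close>
    let ?T = "\<lambda>p. (fst p, v (fst p + snd p *\<^sub>R e))" and ?S = "\<lambda>p. (fst p, \<gamma> (fst p) (snd p))"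
    let ?L = "?D (x + g x *\<^sub>R e)"
    let ?T' = "\<lambda>p. (fst p, ?L (fst p + snd p *\<^sub>R e))"
    let ?S' = "\<lambda>p. (fst p, (snd p - ?L (fst p)) * inverse (?L e))"
    have L: "bounded_linear ?L" by (rule has_derivative_bounded_linear[OF D])
    have Le: "?L e \<noteq> 0" using slope[of "x + g x *\<^sub>R e"] c by auto
    have "((\<lambda>p. fst p + snd p *\<^sub>R e) has_derivative (\<lambda>p. fst p + snd p *\<^sub>R e)) (at (x, g x))"
      by (auto intro!: derivative_eq_intros)
    then have "((\<lambda>p. v (fst p + snd p *\<^sub>R e)) has_derivative (\<lambda>p. ?L (fst p + snd p *\<^sub>R e))) (at (x, g x))"
      by (rule has_derivative_compose) (simp add: D)
    then have T: "(?T has_derivative ?T') (at (?S (x, 0)))"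
      by (simp add: g_def has_derivative_Pair has_derivative_fst)
    have S': "bounded_linear ?S'"
      by (intro bounded_linear_Pair bounded_linear_fst bounded_linear_mult_const bounded_linear_sub
        bounded_linear_snd bounded_linear_compose[OF L])
    have "?S' (?T' p) = p" for p
      using Le by (cases p)
        (simp add: linear_add[OF bounded_linear.linear[OF L]] linear_scale[OF bounded_linear.linear[OF L]])
    then have inv: "?S' \<circ> ?T' = id" by (auto simp: fun_eq_iff)
    have fs: "(fst \<longlongrightarrow> x) (at (x, 0::real))" "(snd \<longlongrightarrow> 0) (at (x, 0::real))"
      using tendsto_fst[OF tendsto_ident_at[of "(x, 0::real)" UNIV]]
        tendsto_snd[OF tendsto_ident_at[of "(x, 0::real)" UNIV]] by simp_all
    have "isCont v (x + g x *\<^sub>R e)" by (rule has_derivative_continuous[OF D])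
    then have "((\<lambda>p. v (fst p + g x *\<^sub>R e)) \<longlongrightarrow> 0) (at (x, 0::real))"
      using isCont_tendsto_compose[OF _ tendsto_add[OF fs(1) tendsto_const]] by (fastforce simp: g0)
    then have "((\<lambda>p. \<bar>snd p - v (fst p + g x *\<^sub>R e)\<bar> / c) \<longlongrightarrow> 0) (at (x, 0))"
      using tendsto_divide[OF tendsto_rabs[OF tendsto_diff[OF fs(2)]] tendsto_const[of c]] c by force
    then have "((\<lambda>p. \<gamma> (fst p) (snd p) - g x) \<longlongrightarrow> 0) (at (x, 0))"
    proof (rule Lim_null_comparison[rotated], intro always_eventually allI)
      fix p :: "'a \<times> real"
      show "norm (\<gamma> (fst p) (snd p) - g x) \<le> \<bar>snd p - v (fst p + g x *\<^sub>R e)\<bar> / c"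
        using expand[of "\<gamma> (fst p) (snd p)" "g x" "fst p"] c
        by (simp add: \<gamma> field_simps)
    qed
    then have "((\<lambda>p. \<gamma> (fst p) (snd p)) \<longlongrightarrow> g x) (at (x, 0))"
      by (rule Lim_null[THEN iffD2])
    then have cont: "continuous (at (x, 0)) ?S"
      using tendsto_Pair[OF fs(1)] by (simp add: continuous_at g_def)
    have S: "(?S has_derivative ?S') (at (x, 0))"
      by (rule has_derivative_inverse_basic[OF T S' inv cont open_UNIV UNIV_I]) (simp add: \<gamma>)
    have "((\<lambda>x. (x, 0::real)) has_derivative (\<lambda>h. (h, 0))) (at x)"
      by (auto intro!: derivative_eq_intros)
    from has_derivative_snd[OF has_derivative_compose[OF this S]] show ?thesis
      by (simp add: g_def[symmetric])
  qed
  \<comment> \<open>Bootstrapping: the derivative of \<open>g\<close> is a smooth function evaluated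
    at \<open>x + g x *\<^sub>R e\<close>, so it inherits level \<open>k\<close> from
    \<open>g\<close>.\<close>
  have "higher_differentiable_on UNIV g k" for k
  proof (induction k)
    case 0
    then show ?case
      using Dg by (auto intro!: continuous_at_imp_continuous_on has_derivative_continuous)
  next
    case (Suc k)
    have "smooth_on UNIV (\<lambda>z. - ?D z h * inverse (?D z e))" for h
    proof (rule smooth_on_mult)
      show "smooth_on UNIV (\<lambda>z. - ?D z h)"
        using smooth_on_diff[OF smooth_on_const[of 0] smooth_on_derivative[OF v]] by simp
      show "smooth_on UNIV (\<lambda>z. inverse (?D z e))"
        using slope c by (intro smooth_on_inverse smooth_on_derivative v) (metis not_less)
    qed
    then have "higher_differentiable_on UNIV
        (\<lambda>x. - ?D (x + g x *\<^sub>R e) h * inverse (?D (x + g x *\<^sub>R e) e)) k" for h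
      by (rule higher_differentiable_on_compose[OF smooth_onD])
        (rule higher_differentiable_on_add[OF
            higher_differentiable_on_bounded_linear[OF bounded_linear_ident]
            higher_differentiable_on_scaleR[OF Suc higher_differentiable_on_const]])
    then show ?case
      by (intro higher_differentiable_on_SucI[OF Dg])
  qed
  then show ?thesis
    by (intro that[of g] smooth_onI pos)
qed

text \<open>Blending \<open>u\<close> with its linearisation outside a small ball yields a function whose derivative in
  the direction \<open>s b\<close> is bounded below on the whole space, so the global implicit function
  theorem applies.\<close>

lemma regular_superlevel_epigraph:
  fixes u :: "'a::euclidean_space \<Rightarrow> real"
  assumes u: "smooth_on UNIV u" and b: "b \<in> Basis" and Db: "frechet_derivative u (at p) b \<noteq> 0"
    and R: "0 < R"
  obtains r s g where "0 < r" "r \<le> R" "s \<in> {-1, 1::real}" "smooth_on UNIV g"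
    "\<And>x. x \<in> ball p r \<Longrightarrow> u p < u x \<longleftrightarrow> g (x - (x \<bullet> b) *\<^sub>R b) < s * (x \<bullet> b)"
proof -
  let ?D = "\<lambda>x. frechet_derivative u (at x)"
  note D = smooth_on_has_derivative[OF u]
  have L: "bounded_linear (?D p)" by (rule has_derivative_bounded_linear[OF D])
  define s where "s = sgn (?D p b)"
  have s: "s \<in> {-1, 1}" using Db by (auto simp: s_def sgn_if)
  define d where "d = \<bar>?D p b\<bar>"
  have d: "0 < d" "s * ?D p b = d" using Db by (auto simp: d_def s_def sgn_if)
  obtain \<eta> :: "'a \<Rightarrow> real" where \<eta>: "smooth_on UNIV \<eta>"
    "\<And>x. 0 \<le> \<eta> x" "\<And>x. \<eta> x \<le> 1"
    "\<And>x. norm x \<le> 1 \<Longrightarrow> \<eta> x = 1" "\<And>x. 2 \<le> norm x \<Longrightarrow> \<eta> x = 0"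
    using smooth_bump_exists by blast
  let ?E = "\<lambda>x. frechet_derivative \<eta> (at x)"
  note E = smooth_on_has_derivative[OF \<eta>(1)]
  have "{x. \<eta> x \<noteq> 0} \<subseteq> cball 0 2" using \<eta>(5) by (auto simp: not_le[symmetric]) (meson linear)
  then have "\<eta> \<in> test_functions"
    using \<eta>(1) by (intro test_functionsI bounded_subset[OF bounded_cball])
  then obtain M where M: "0 \<le> M" "\<And>x. \<bar>?E x b\<bar> \<le> M"
    using test_functions_bounded[OF test_functions_derivative] by blast
  \<comment> \<open>Points of norm at least 2, including the sphere itself, are global minima of
    \<eta>.\<close>
  have E0: "?E x h = 0" if "2 \<le> norm x" for x h
    using differential_zero_maxmin[OF UNIV_I open_UNIV E] \<eta>(2,5) that by metis
  \<comment> \<open>The derivative of the blend differs from the linear part by two errors: at most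
    \<epsilon> from the change of the derivative of \<open>u\<close>, and at most
    \<open>M * (\<epsilon> * (2 * r)) / r\<close> from the derivative of the rescaled bump, whose
    factor \<open>1 / r\<close> is absorbed by the first-order smallness of \<open>w\<close>. Their
    sum is to be half of the slope \<open>d\<close>.\<close>
  define \<epsilon> where "\<epsilon> = d / (2 * (1 + 2 * M))"
  have \<epsilon>: "0 < \<epsilon>" "\<epsilon> * (1 + 2 * M) = d / 2"
    using d M by (auto simp: \<epsilon>_def field_simps)
  define w where "w x = u x - u p - ?D p (x - p)" for x
  obtain d1 where d1: "0 < d1" "\<And>x. norm (x - p) < d1 \<Longrightarrow> \<bar>w x\<bar> \<le> \<epsilon> * norm (x - p)"
    using D[of p] \<epsilon>(1) unfolding has_derivative_at_alt w_def real_norm_def by blast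
  have "isCont (\<lambda>x. ?D x b) p"
    using smooth_on_continuous[OF smooth_on_derivative[OF u]] by (simp add: continuous_on_eq_continuous_at)
  then obtain d2 where d2: "0 < d2" "\<And>x. norm (x - p) < d2 \<Longrightarrow> \<bar>?D x b - ?D p b\<bar> < \<epsilon>"
    using \<epsilon>(1) unfolding continuous_at_eps_delta dist_norm real_norm_def by blast
  \<comment> \<open>Blending takes place in the ball of radius \<open>2 * r\<close>, which must lie
    within both radii of validity; the thirds ensure this strictly.\<close>
  define r where "r = Min {R, d1 / 3, d2 / 3}"
  have r: "0 < r" "r \<le> R" "2 * r < d1" "2 * r < d2"
    using R d1(1) d2(1) by (auto simp: r_def min_def)
  let ?z = "\<lambda>x. (1 / r) *\<^sub>R (x - p)"
  define v where "v x = ?D p (x - p) + \<eta> (?z x) * w x" for x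
  have z: "smooth_on UNIV ?z"
    by (intro smooth_on_scaleR smooth_on_diff smooth_on_const smooth_on_bounded_linear bounded_linear_ident)
  have lin: "smooth_on UNIV (\<lambda>x. ?D p (x - p))"
    by (rule smooth_on_compose[OF smooth_on_bounded_linear[OF L]
        smooth_on_diff[OF smooth_on_bounded_linear[OF bounded_linear_ident] smooth_on_const]])
  have v: "smooth_on UNIV v"
    unfolding v_def w_def
    by (intro smooth_on_add smooth_on_mult smooth_on_diff smooth_on_const u lin smooth_on_compose[OF \<eta>(1) z])
  have Dv: "frechet_derivative v (at x) =
      (\<lambda>h. ?D p h + (\<eta> (?z x) * (?D x h - ?D p h) + ?E (?z x) ((1 / r) *\<^sub>R h) * w x))" for x
  proof (rule frechet_derivative_at[symmetric])
    have "((\<lambda>x. x - p) has_derivative (\<lambda>h. h)) (at x)" "(?z has_derivative (\<lambda>h. (1 / r) *\<^sub>R h)) (at x)"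
      by (auto intro!: derivative_eq_intros)
    then have "((\<lambda>x. ?D p (x - p)) has_derivative ?D p) (at x)"
      "((\<lambda>x. \<eta> (?z x)) has_derivative (\<lambda>h. ?E (?z x) ((1 / r) *\<^sub>R h))) (at x)"
      using bounded_linear.has_derivative[OF L] has_derivative_compose[OF _ E] by blast+
    then show "(v has_derivative
      (\<lambda>h. ?D p h + (\<eta> (?z x) * (?D x h - ?D p h) + ?E (?z x) ((1 / r) *\<^sub>R h) * w x))) (at x)"
      unfolding v_def w_def using D[of x] by (auto intro!: derivative_eq_intros)
  qed
  have "d / 2 \<le> frechet_derivative v (at x) (s *\<^sub>R b)" for x
  proof -
    let ?t = "\<eta> (?z x) * (?D x b - ?D p b) + ?E (?z x) b / r * w x"
    have "frechet_derivative v (at x) (s *\<^sub>R b) = s * frechet_derivative v (at x) b"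
      using linear_scale[OF has_derivative_linear[OF smooth_on_has_derivative[OF v]]] by simp
    also have "frechet_derivative v (at x) b = ?D p b + ?t"
      using linear_scale[OF has_derivative_linear[OF E], of _ "1 / r" b] by (simp add: Dv)
    finally have eq: "frechet_derivative v (at x) (s *\<^sub>R b) = d + s * ?t"
      by (simp add: distrib_left d(2))
    have "\<bar>?t\<bar> \<le> d / 2"
    proof (cases "norm (x - p) < 2 * r")
      case True
      have "\<bar>?E (?z x) b / r * w x\<bar> = \<bar>?E (?z x) b\<bar> * \<bar>w x\<bar> / r"
        using r by (simp add: abs_mult)
      also have "\<dots> \<le> M * (\<epsilon> * (2 * r)) / r"
        using r True \<epsilon>(1) M d1(2)[of x]
        by (intro divide_right_mono mult_mono M) (auto intro: order.trans[OF d1(2)])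
      also have "\<dots> = \<epsilon> * (2 * M)" using r by simp
      finally have 2: "\<bar>?E (?z x) b / r * w x\<bar> \<le> \<epsilon> * (2 * M)" .
      have "\<bar>\<eta> (?z x) * (?D x b - ?D p b)\<bar> \<le> 1 * \<epsilon>"
        unfolding abs_mult using True r \<eta>(2,3) d2(2)[of x] by (intro mult_mono) auto
      moreover have "\<epsilon> * (2 * M) + 1 * \<epsilon> = d / 2" using \<epsilon>(2) by (simp add: algebra_simps)
      ultimately show ?thesis using 2 by linarith
    next
      case False
      then have "2 \<le> norm (?z x)" unfolding norm_scaleR using r by (simp add: field_simps)
      then show ?thesis using E0 \<eta>(5) d by simp
    qed
    then have "\<bar>s * ?t\<bar> \<le> d / 2" using s by (auto simp: abs_mult)
    moreover have "d / 2 \<le> d + y" if "\<bar>y\<bar> \<le> d / 2" for y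
      using that by linarith
    ultimately show ?thesis unfolding eq by blast
  qed
  then obtain g where g: "smooth_on UNIV g" "\<And>x y. 0 < v (x + y *\<^sub>R s *\<^sub>R b) \<longleftrightarrow> g x < y"
    using smooth_global_implicit_function[OF v, of "d / 2" "s *\<^sub>R b"] d by auto
  show ?thesis
  proof (rule that[OF r(1,2) s g(1)])
    fix x assume "x \<in> ball p r"
    then have "norm (?z x) \<le> 1"
      unfolding norm_scaleR using r by (simp add: dist_norm norm_minus_commute)
    then have "v x = u x - u p" using \<eta>(4) by (simp add: v_def w_def)
    moreover have "x - (x \<bullet> b) *\<^sub>R b + (s * (x \<bullet> b)) *\<^sub>R s *\<^sub>R b = x"
      using s by auto
    ultimately show "u p < u x \<longleftrightarrow> g (x - (x \<bullet> b) *\<^sub>R b) < s * (x \<bullet> b)"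
      using g(2)[of "x - (x \<bullet> b) *\<^sub>R b" "s * (x \<bullet> b)"] by (simp del: scaleR_scaleR)
  qed
qed

text \<open>A nonzero linear form is nonzero on some basis vector, which serves as the axis of the
  graph. The defining function \<open>u\<close> may vary with \<open>p\<close>, so a set given by a
  nonsmooth function qualifies if that function is smooth near each boundary point.\<close>

lemma smooth_boundaryI:
  fixes U :: "'a::euclidean_space set"
  assumes "\<And>p. p \<in> frontier U \<Longrightarrow> \<exists>R>0. \<exists>u::'a \<Rightarrow> real. smooth_on UNIV u \<and>
    (\<exists>h. frechet_derivative u (at p) h \<noteq> 0) \<and> U \<inter> ball p R = {x \<in> ball p R. u p < u x}"
  shows "smooth_boundary U"
  unfolding smooth_boundary_def
proof
  fix p assume "p \<in> frontier U"
  from assms[OF this] obtain R h and u :: "'a \<Rightarrow> real" where R: "0 < R" and u: "smooth_on UNIV u"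
    and h: "frechet_derivative u (at p) h \<noteq> 0"
    and U: "U \<inter> ball p R = {x \<in> ball p R. u p < u x}"
    by blast
  have "\<not> (\<forall>b\<in>Basis. frechet_derivative u (at p) b = 0)"
  proof
    assume "\<forall>b\<in>Basis. frechet_derivative u (at p) b = 0"
    then have "\<bar>frechet_derivative u (at p) h\<bar> \<le> (\<Sum>b\<in>(Basis :: 'a set). 0) * norm h"
      by (intro abs_linear_le_sum_Basis has_derivative_linear[OF smooth_on_has_derivative[OF u]]) simp
    with h show False by simp
  qed
  then obtain b where b: "b \<in> Basis" "frechet_derivative u (at p) b \<noteq> 0" by blast
  obtain r s g where *: "0 < r" "r \<le> R" "s \<in> {-1, 1::real}" "smooth_on UNIV g"
    "\<And>x. x \<in> ball p r \<Longrightarrow> u p < u x \<longleftrightarrow> g (x - (x \<bullet> b) *\<^sub>R b) < s * (x \<bullet> b)"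
    using regular_superlevel_epigraph[OF u b R] by metis
  have "U \<inter> ball p r = (U \<inter> ball p R) \<inter> ball p r"
    using *(2) subset_ball[of r R p] by blast
  also have "\<dots> = {x \<in> ball p r. u p < u x}"
    unfolding U using *(2) subset_ball[of r R p] by blast
  also have "\<dots> = {x \<in> ball p r. g (x - (x \<bullet> b) *\<^sub>R b) < s * (x \<bullet> b)}"
    using *(5) by blast
  finally show "\<exists>r>0. \<exists>b\<in>Basis. \<exists>s\<in>{- 1, 1}. \<exists>g. smooth_on UNIV g \<and>
      U \<inter> ball p r = {x \<in> ball p r. g (x - (x \<bullet> b) *\<^sub>R b) < s * (x \<bullet> b)}"
    using *(1,3,4) b(1) by blast
qed

section \<open>Mollification and generic regular values\<close>

lemma smooth_on_borel_measurable:
  "smooth_on UNIV f \<Longrightarrow> f \<in> borel_measurable borel"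
  by (rule borel_measurable_continuous_onI[OF smooth_on_continuous])

text \<open>Differentiation falls on the test function and again produces a convolution with a test
  function, so the induction runs over all test functions. The uniform quadratic remainder,
  multiplied by the finite measure of \<open>U\<close>, justifies each differentiation under the
  integral.\<close>

lemma smooth_on_indicator_convolution:
  fixes \<rho> :: "'a::euclidean_space \<Rightarrow> real"
  assumes [measurable]: "U \<in> sets borel" and U: "bounded U" and \<rho>: "\<rho> \<in> test_functions"
  shows "smooth_on UNIV (\<lambda>x. LINT y|lborel. indicator U y * \<rho> (x - y))"
proof -
  have fin: "emeasure lborel U < \<infinity>" by (rule emeasure_bounded_finite[OF U])
  then have indU: "integrable lborel (\<lambda>y. c * indicator U y :: real)" for c
    by (intro integrable_mult_right integrable_real_indicator) simp_all
  have int: "integrable lborel (\<lambda>y. indicator U y * \<sigma> (x - y))" if \<sigma>: "\<sigma> \<in> test_functions"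
    for \<sigma> :: "'a \<Rightarrow> real" and x
  proof -
    have [measurable]: "\<sigma> \<in> borel_measurable borel"
      by (rule smooth_on_borel_measurable[OF test_functionsD(1)[OF \<sigma>]])
    obtain M where M: "0 \<le> M" "\<And>x. \<bar>\<sigma> x\<bar> \<le> M" using test_functions_bounded[OF \<sigma>] by blast
    show ?thesis
      by (rule Bochner_Integration.integrable_bound[OF indU[of M]])
        (use M in \<open>auto simp: indicator_def\<close>)
  qed
  have deriv: "((\<lambda>x. LINT y|lborel. indicator U y * \<sigma> (x - y)) has_derivative
      (\<lambda>v. LINT y|lborel. indicator U y * frechet_derivative \<sigma> (at (x - y)) v)) (at x)"
    if \<sigma>: "\<sigma> \<in> test_functions" for \<sigma> :: "'a \<Rightarrow> real" and x
  proof -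
    let ?D = "\<lambda>x. frechet_derivative \<sigma> (at x)"
    note D = has_derivative_linear[OF smooth_on_has_derivative[OF test_functionsD(1)[OF \<sigma>]]]
    note int' = int[OF test_functions_derivative[OF \<sigma>]]
    obtain C where C: "0 \<le> C" "\<And>x v. \<bar>\<sigma> (x + v) - \<sigma> x - ?D x v\<bar> \<le> C * norm v ^ 2"
      using test_functions_quadratic_remainder[OF \<sigma>] by blast
    let ?F = "\<lambda>x. LINT y|lborel. indicator U y * \<sigma> (x - y)"
    let ?F' = "\<lambda>v. LINT y|lborel. indicator U y * ?D (x - y) v"
    let ?V = "measure lborel U"
    have "linear ?F'"
    proof (rule linearI)
      show "?F' (v + w) = ?F' v + ?F' w" for v w
        using Bochner_Integration.integral_add[OF int' int', of x v x w]
        by (simp add: linear_add[OF D] distrib_left)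
      show "?F' (c *\<^sub>R v) = c *\<^sub>R ?F' v" for c v
        by (simp add: linear_scale[OF D] mult.left_commute[of _ c])
    qed
    then have bl: "bounded_linear ?F'" by (simp add: linear_conv_bounded_linear)
    have est: "\<bar>?F z - ?F x - ?F' (z - x)\<bar> \<le> C * norm (z - x) ^ 2 * ?V" for z
    proof -
      have "?F z - ?F x - ?F' (z - x) =
          (LINT y|lborel. indicator U y * \<sigma> (z - y) - indicator U y * \<sigma> (x - y) - indicator U y * ?D (x - y) (z - x))"
        by (simp add: int[OF \<sigma>] int')
      also have "\<bar>\<dots>\<bar> \<le> (LINT y|lborel. (C * norm (z - x) ^ 2) * indicator U y)"
      proof (rule order.trans[OF integral_abs_bound integral_mono])
        show "integrable lborel (\<lambda>y. \<bar>indicator U y * \<sigma> (z - y) - indicator U y * \<sigma> (x - y) - indicator U y * ?D (x - y) (z - x)\<bar>)"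
          by (intro integrable_abs Bochner_Integration.integrable_diff int[OF \<sigma>] int')
        show "integrable lborel (\<lambda>y. (C * norm (z - x) ^ 2) * indicator U y :: real)"
          by (rule indU)
        show "\<bar>indicator U y * \<sigma> (z - y) - indicator U y * \<sigma> (x - y) - indicator U y * ?D (x - y) (z - x)\<bar>
            \<le> C * norm (z - x) ^ 2 * indicator U y" for y
          using C(2)[of "x - y" "z - x"] by (simp add: indicator_def)
      qed
      also have "\<dots> = C * norm (z - x) ^ 2 * ?V" by simp
      finally show ?thesis .
    qed
    show ?thesis
    proof (rule has_derivativeI_sandwich[of 1, OF _ bl])
      show "norm (?F z - ?F x - ?F' (z - x)) / norm (z - x) \<le> C * ?V * norm (z - x)" if "z \<noteq> x" for z
        using est[of z] that by (simp add: field_simps power2_eq_square)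
      show "((\<lambda>z. C * ?V * norm (z - x)) \<longlongrightarrow> 0) (at x)"
        by (auto intro!: tendsto_eq_intros)
    qed simp_all
  qed
  have "higher_differentiable_on UNIV (\<lambda>x. LINT y|lborel. indicator U y * \<sigma> (x - y)) k"
    if "\<sigma> \<in> test_functions" for \<sigma> :: "'a \<Rightarrow> real" and k
    using that
  proof (induction k arbitrary: \<sigma>)
    case 0
    then show ?case
      using deriv by (auto intro!: continuous_at_imp_continuous_on has_derivative_continuous)
  next
    case (Suc k)
    show ?case
      by (rule higher_differentiable_on_SucI[OF deriv[OF Suc.prems]])
        (rule Suc.IH[OF test_functions_derivative[OF Suc.prems]])
  qed
  then show ?thesis using \<rho> by (intro smooth_onI)
qed

lemma smooth_mollifier_exists:
  fixes d :: real
  assumes d: "0 < d"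
  obtains \<rho> :: "'a::euclidean_space \<Rightarrow> real" where "\<rho> \<in> test_functions" "\<And>x. 0 \<le> \<rho> x"
    "\<And>x. d \<le> norm x \<Longrightarrow> \<rho> x = 0" "integrable lborel \<rho>" "integral\<^sup>L lborel \<rho> = 1"
proof -
  obtain \<eta> :: "'a \<Rightarrow> real" where \<eta>: "smooth_on UNIV \<eta>" "\<And>x. 0 \<le> \<eta> x" "\<And>x. \<eta> x \<le> 1"
    "\<And>x. norm x \<le> 1 \<Longrightarrow> \<eta> x = 1" "\<And>x. 2 \<le> norm x \<Longrightarrow> \<eta> x = 0"
    using smooth_bump_exists by blast
  \<comment> \<open>The scaling carries the radii 1 and 2 of the bump to \<open>d / 2\<close> and
    \<open>d\<close>; the plateau makes the mass positive, so it can be normalised.\<close>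
  define \<eta>d where "\<eta>d x = \<eta> ((2 / d) *\<^sub>R x)" for x
  have s: "smooth_on UNIV \<eta>d"
    unfolding \<eta>d_def
    by (rule smooth_on_compose[OF \<eta>(1) smooth_on_bounded_linear[OF bounded_linear_scaleR_right]])
  have zero: "\<eta>d x = 0" if "d \<le> norm x" for x
    unfolding \<eta>d_def using that d by (intro \<eta>(5)) (simp add: field_simps)
  have one: "\<eta>d x = 1" if "norm x \<le> d / 2" for x
    unfolding \<eta>d_def using that d by (intro \<eta>(4)) (simp add: field_simps)
  have nonneg: "0 \<le> \<eta>d x" and le1: "\<eta>d x \<le> 1" for x
    using \<eta>(2,3) by (simp_all add: \<eta>d_def)
  have [measurable]: "\<eta>d \<in> borel_measurable borel" by (rule smooth_on_borel_measurable[OF s])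
  have intB: "integrable lborel (indicator (cball 0 r) :: 'a \<Rightarrow> real)" for r
    using emeasure_bounded_finite[OF bounded_cball] by (intro integrable_real_indicator) auto
  have int: "integrable lborel \<eta>d"
  proof (rule Bochner_Integration.integrable_bound[OF intB[of d]])
    show "AE x in lborel. norm (\<eta>d x) \<le> norm (indicator (cball 0 d) x :: real)"
      using zero nonneg le1 by (intro AE_I2) (auto simp: indicator_def abs_le_iff intro: order.trans[of _ 0])
  qed simp
  define m where "m = integral\<^sup>L lborel \<eta>d"
  have "0 < measure lborel (cball (0::'a) (d / 2))"
    using d by (simp add: content_cball_pos)
  also have "\<dots> = (LINT x|lborel. indicator (cball (0::'a) (d / 2)) x)" by simp
  also have "\<dots> \<le> m"
    unfolding m_def by (rule integral_mono[OF intB int]) (use one nonneg in \<open>auto simp: indicator_def\<close>)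
  finally have m: "0 < m" .
  show ?thesis
  proof (rule that[of "\<lambda>x. inverse m * \<eta>d x"])
    have "{x. inverse m * \<eta>d x \<noteq> 0} \<subseteq> cball 0 d"
      using zero by (auto simp: not_le[symmetric]) (meson linear)
    then show "(\<lambda>x. inverse m * \<eta>d x) \<in> test_functions"
      by (intro test_functionsI smooth_on_mult smooth_on_const s bounded_subset[OF bounded_cball])
    show "integrable lborel (\<lambda>x. inverse m * \<eta>d x)" using int by simp
    show "(LINT x|lborel. inverse m * \<eta>d x) = 1" using m by (simp flip: m_def)
  qed (use m nonneg zero in auto)
qed

lemma frac_sobolev_cap_le_perimeter:
  fixes K :: "'a::euclidean_space set"
  assumes K: "compact K" "K \<subseteq> U" and U: "open U" "bounded U"
  shows "frac_sobolev_cap \<alpha> K \<le> 2 * frac_perimeter \<alpha> U"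
proof -
  obtain d where d: "0 < d" "(\<Union>x\<in>K. ball x d) \<subseteq> U"
    using compact_subset_open_imp_ball_epsilon_subset[OF K(1) U(1) K(2)] by blast
  obtain \<rho> :: "'a \<Rightarrow> real" where \<rho>: "\<rho> \<in> test_functions" "\<And>x. 0 \<le> \<rho> x"
    "\<And>x. d \<le> norm x \<Longrightarrow> \<rho> x = 0" "integrable lborel \<rho>" "integral\<^sup>L lborel \<rho> = 1"
    using smooth_mollifier_exists[OF d(1)] by blast
  have [measurable]: "U \<in> sets borel" "\<rho> \<in> borel_measurable borel"
    using U(1) smooth_on_borel_measurable[OF test_functionsD(1)[OF \<rho>(1)]] by auto
  define F where "F x = (LINT z|lborel. \<rho> z * indicator U (x - z))" for x
  \<comment> \<open>Two forms of the same convolution: moving the translation onto the indicator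
    suits the seminorm estimate, moving it onto \<rho> suits smoothness.\<close>
  have F': "F x = (LINT y|lborel. indicator U y * \<rho> (x - y))" for x
    unfolding F_def
    by (subst lborel_distr_reflect[of x, symmetric], subst integral_distr) (simp_all add: mult.commute)
  obtain B where B: "\<And>x. x \<in> U \<Longrightarrow> norm x \<le> B" using U(2) bounded_iff by metis
  have "F x = 0" if "B + d < norm x" for x
  proof -
    have "indicator U y * \<rho> (x - y) = 0" for y :: 'a
      using that B[of y] \<rho>(3)[of "x - y"] norm_triangle_ineq2[of x y]
      by (auto simp: indicator_def)
    then have "(\<lambda>y. indicator U y * \<rho> (x - y)) = (\<lambda>y. 0)" by (rule ext)
    then show ?thesis unfolding F' by simp
  qed
  then have "{x. F x \<noteq> 0} \<subseteq> cball 0 (B + d)"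
    unfolding subset_iff mem_Collect_eq mem_cball_0 using not_le by blast
  then have supp: "bounded {x. F x \<noteq> 0}"
    by (rule bounded_subset[OF bounded_cball])
  have "smooth_on UNIV F"
    unfolding F'[abs_def] by (rule smooth_on_indicator_convolution[OF _ U(2) \<rho>(1)]) simp
  then have "F \<in> test_functions"
    using supp by (rule test_functionsI)
  moreover have "indicator K x \<le> F x" for x
  proof (cases "x \<in> K")
    case True
    have "\<rho> z * indicator U (x - z) = \<rho> z" for z
    proof (cases "d \<le> norm z")
      case False
      then have "x - z \<in> ball x d" by (simp add: dist_norm)
      then have "x - z \<in> U" using True d(2) by blast
      then show ?thesis by simp
    qed (simp add: \<rho>(3))
    then have "(\<lambda>z. \<rho> z * indicator U (x - z)) = \<rho>" by (rule ext)
    then show ?thesis using True \<rho>(5) by (simp add: F_def)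
  next
    case False
    then show ?thesis unfolding F_def using \<rho>(2) by (simp add: Bochner_Integration.integral_nonneg)
  qed
  ultimately have "frac_sobolev_cap \<alpha> K \<le> frac_sobolev_norm \<alpha> F"
    unfolding frac_sobolev_cap_def by (intro INF_lower) auto
  also have "\<dots> \<le> frac_sobolev_norm \<alpha> (indicator U)"
    unfolding F_def by (rule frac_sobolev_norm_convolution_le) (use \<rho> in auto)
  also have "\<dots> = 2 * frac_perimeter \<alpha> U"
    by (rule frac_sobolev_norm_indicator) simp
  finally show ?thesis .
qed

text \<open>The pairs \<open>(a, t)\<close> for which \<open>t\<close> is a critical value of \<open>f + a \<bullet> x\<close> form the image of
  \<open>x \<mapsto> (- grad f x, f x - grad f x \<bullet> x)\<close>, a differentiable map into a space of one dimension more.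
  This replaces Sard's theorem for \<open>f\<close>.\<close>

lemma AE_regular_value_linear_perturbation:
  fixes f :: "'a::euclidean_space \<Rightarrow> real"
  assumes f: "smooth_on UNIV f"
  shows "AE a in lborel. AE t in lborel.
    \<forall>x. f x + a \<bullet> x = t \<longrightarrow> (\<exists>h. frechet_derivative f (at x) h + a \<bullet> h \<noteq> 0)"
proof -
  let ?D = "\<lambda>x. frechet_derivative f (at x)"
  define G where "G x = (\<Sum>b\<in>Basis. ?D x b *\<^sub>R b)" for x
  define \<Phi> where "\<Phi> x = (- G x, f x - G x \<bullet> x)" for x
  have "smooth_on UNIV (\<lambda>x. ?D x b *\<^sub>R b)" for b
    by (rule smooth_on_scaleR[OF smooth_on_derivative[OF f] smooth_on_const])
  then have "smooth_on UNIV G"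
    unfolding G_def smooth_on_def by (intro allI higher_differentiable_on_sum) blast
  note DG = smooth_on_has_derivative[OF this]
  have "\<Phi> differentiable_on UNIV"
    unfolding \<Phi>_def differentiable_on_def
    by (intro ballI differentiableI[OF has_derivative_Pair[OF has_derivative_minus[OF DG]
        has_derivative_diff[OF smooth_on_has_derivative[OF f] has_derivative_inner[OF DG has_derivative_ident]]]])
  then have "negligible (range \<Phi>)"
    by (intro negligible_differentiable_image_lowdim) simp_all
  then have "AE p in lebesgue. p \<notin> range \<Phi>"
    by (intro AE_not_in) (simp add: negligible_iff_null_sets)
  \<comment> \<open>Slicing the null set in the product separates the choice of \<open>a\<close>
    from that of \<open>t\<close>.\<close>
  then have "AE p in lborel \<Otimes>\<^sub>M lborel. p \<notin> range \<Phi>"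
    unfolding lborel_prod by (simp add: AE_completion_iff)
  then have ae: "AE a in lborel. AE t in lborel. (a, t) \<notin> range \<Phi>"
    by (rule lborel_pair.AE_pair)
  have "(a, f x + a \<bullet> x) = \<Phi> x" if "\<And>h. ?D x h + a \<bullet> h = 0" for a x
  proof -
    have "a \<bullet> b = (- G x) \<bullet> b" if "b \<in> Basis" for b
      using \<open>?D x b + a \<bullet> b = 0\<close> that by (simp add: G_def inner_sum_left_Basis)
    then have "a = - G x" by (rule euclidean_eqI)
    then show ?thesis by (simp add: \<Phi>_def)
  qed
  then have "\<exists>h. ?D x h + a \<bullet> h \<noteq> 0" if "(a, t) \<notin> range \<Phi>" "f x + a \<bullet> x = t" for a t x
    using that by (metis rangeI)
  then have *: "\<forall>x. f x + a \<bullet> x = t \<longrightarrow> (\<exists>h. ?D x h + a \<bullet> h \<noteq> 0)" if "(a, t) \<notin> range \<Phi>" for a t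
    using that by blast
  show ?thesis
    by (rule eventually_mono[OF ae]) (erule eventually_mono, rule *)
qed

text \<open>The factor is 1 up to radius \<open>R\<close>, 0 from \<open>R + 1\<close> on, and has
  slope at most 1. In the product rule the slope meets a linear form of size at most
  \<open>norm a * (R + 1)\<close>, and the factor itself contributes \<open>norm a\<close>: hence
  \<open>R + 2\<close>. The same constant serves for the sup bound.\<close>

lemma cutoff_linear_Lipschitz:
  fixes a x y :: "'a::euclidean_space"
  assumes R: "0 < R"
  defines "g \<equiv> \<lambda>x. max 0 (min 1 (R + 1 - norm x)) * (a \<bullet> x)"
  shows "\<bar>g x\<bar> \<le> norm a * (R + 2)"
    and "\<bar>g x - g y\<bar> \<le> norm a * (R + 2) * norm (x - y)"
proof -
  let ?c = "\<lambda>x::'a. max 0 (min 1 (R + 1 - norm x))"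
  show "\<bar>g x\<bar> \<le> norm a * (R + 2)"
  proof (cases "norm x \<le> R + 1")
    case True
    have "\<bar>g x\<bar> \<le> 1 * (norm a * norm x)"
      unfolding g_def abs_mult by (intro mult_mono Cauchy_Schwarz_ineq2) auto
    also have "\<dots> \<le> norm a * (R + 2)" using True by (auto intro!: mult_left_mono)
    finally show ?thesis .
  qed (use R in \<open>simp add: g_def\<close>)
  \<comment> \<open>The splitting bounds the linear form only at \<open>y\<close>. If
    \<open>y\<close> is outside, the roles are exchanged, or both values are 0.\<close>
  have *: "\<bar>g x - g y\<bar> \<le> norm a * (R + 2) * norm (x - y)" if "norm y \<le> R + 1" for x y
  proof -
    have "g x - g y = (?c x - ?c y) * (a \<bullet> y) + ?c x * (a \<bullet> (x - y))"
      by (simp add: g_def algebra_simps inner_diff_right)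
    also have "\<bar>\<dots>\<bar> \<le> \<bar>?c x - ?c y\<bar> * \<bar>a \<bullet> y\<bar> + \<bar>?c x\<bar> * \<bar>a \<bullet> (x - y)\<bar>"
      by (rule order.trans[OF abs_triangle_ineq]) (simp add: abs_mult)
    also have "\<dots> \<le> norm (x - y) * (norm a * (R + 1)) + 1 * (norm a * norm (x - y))"
    proof (intro add_mono mult_mono Cauchy_Schwarz_ineq2)
      show "\<bar>?c x - ?c y\<bar> \<le> norm (x - y)"
        using norm_triangle_ineq3[of x y] by (auto simp: max_def min_def abs_if split: if_splits)
      show "\<bar>a \<bullet> y\<bar> \<le> norm a * (R + 1)"
        using Cauchy_Schwarz_ineq2[of a y] mult_left_mono[OF that, of "norm a"] by simp
    qed auto
    finally show ?thesis by (simp add: algebra_simps)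
  qed
  show "\<bar>g x - g y\<bar> \<le> norm a * (R + 2) * norm (x - y)"
  proof (cases "norm y \<le> R + 1")
    case False
    show ?thesis
    proof (cases "norm x \<le> R + 1")
      case True
      then show ?thesis using *[of x y] by (simp add: abs_minus_commute norm_minus_commute)
    qed (use False R in \<open>simp add: g_def\<close>)
  qed (rule *)
qed

text \<open>Outside radius \<open>R\<close> the function is at most \<epsilon> < \<open>t\<close>,
  and on \<open>K\<close> it is at least \<open>1 - \<epsilon>\<close> > \<open>t\<close>. By
  continuity boundary points lie on the level \<open>t\<close>, hence strictly inside radius
  \<open>R\<close>; near them the cutoff equals 1, so the function there is the smooth
  \<open>f x + a \<bullet> x\<close>.\<close>

lemma superlevel_in_smooth_open_nbhds:
  fixes f :: "'a::euclidean_space \<Rightarrow> real"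
  assumes f: "smooth_on UNIV f" "\<And>x. R \<le> norm x \<Longrightarrow> f x = 0" "\<And>x. indicator K x \<le> f x"
    and R: "0 < R" and K: "\<And>x. x \<in> K \<Longrightarrow> norm x < R"
    and a: "norm a * (R + 2) \<le> \<epsilon>" and t: "\<epsilon> < t" "t < 1 - \<epsilon>"
    and regular: "\<And>x. f x + a \<bullet> x = t \<Longrightarrow> \<exists>h. frechet_derivative f (at x) h + a \<bullet> h \<noteq> 0"
  shows "{x. t < f x + max 0 (min 1 (R + 1 - norm x)) * (a \<bullet> x)} \<in> smooth_open_nbhds K"
proof -
  define g where "g x = max 0 (min 1 (R + 1 - norm x)) * (a \<bullet> x)" for x
  define u where "u x = f x + g x" for x
  let ?U = "{x. t < u x}"
  have g: "\<bar>g x\<bar> \<le> \<epsilon>" for x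
    unfolding g_def by (rule order.trans[OF cutoff_linear_Lipschitz(1)[OF R] a])
  have "0 \<le> norm a * (R + 2)" using R by simp
  then have \<epsilon>: "0 \<le> \<epsilon>" using a by linarith
  have inside: "norm x < R" if "t \<le> u x" for x
    using that g[of x] t f(2)[of x] by (cases "R \<le> norm x") (auto simp: u_def)
  have u_eq: "u x = f x + a \<bullet> x" if "norm x < R" for x
    using that by (simp add: u_def g_def)
  have cont: "continuous_on UNIV u"
    unfolding u_def g_def by (intro continuous_intros smooth_on_continuous f(1))
  have op: "open ?U"
    by (rule open_Collect_less[OF continuous_on_const cont])
  have "?U \<subseteq> ball 0 R" using inside by (auto simp: less_imp_le)
  then have bd: "bounded ?U" by (rule bounded_subset[OF bounded_ball])
  have "K \<subseteq> ?U"
  proof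
    fix x assume "x \<in> K"
    then have "1 \<le> f x" using f(3)[of x] by simp
    then show "x \<in> ?U" using g[of x] t by (simp add: u_def)
  qed
  moreover have "smooth_boundary ?U"
  proof (rule smooth_boundaryI)
    fix p assume p: "p \<in> frontier ?U"
    have "closure ?U \<subseteq> {x. t \<le> u x}"
      by (intro closure_minimal closed_Collect_le[OF continuous_on_const cont]) auto
    then have "t \<le> u p" using p by (auto simp: frontier_def)
    moreover have "p \<notin> ?U" using p op by (auto simp: frontier_def interior_open)
    ultimately have up: "u p = t" by simp
    then have pR: "norm p < R" using inside by simp
    let ?w = "\<lambda>x. f x + a \<bullet> x"
    have lin: "bounded_linear (\<lambda>x. a \<bullet> x)" by (rule bounded_linear_inner_right)
    have w: "smooth_on UNIV ?w"
      by (rule smooth_on_add[OF f(1) smooth_on_bounded_linear[OF lin]])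
    have "(?w has_derivative (\<lambda>h. frechet_derivative f (at p) h + a \<bullet> h)) (at p)"
      by (rule has_derivative_add[OF smooth_on_has_derivative[OF f(1)] bounded_linear_imp_has_derivative[OF lin]])
    then have Dw: "frechet_derivative ?w (at p) = (\<lambda>h. frechet_derivative f (at p) h + a \<bullet> h)"
      by (rule frechet_derivative_at[symmetric])
    have wp: "?w p = t" using u_eq[OF pR] up by simp
    have "norm x < R" if "x \<in> ball p (R - norm p)" for x
      using that norm_triangle_ineq2[of x p] by (simp add: dist_norm norm_minus_commute)
    then have "?U \<inter> ball p (R - norm p) = {x \<in> ball p (R - norm p). ?w p < ?w x}"
      unfolding wp using u_eq by auto
    moreover have "\<exists>h. frechet_derivative ?w (at p) h \<noteq> 0"
      unfolding Dw by (rule regular[OF wp])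
    ultimately show "\<exists>R>0. \<exists>u::'a \<Rightarrow> real. smooth_on UNIV u \<and>
        (\<exists>h. frechet_derivative u (at p) h \<noteq> 0) \<and> ?U \<inter> ball p R = {x \<in> ball p R. u p < u x}"
      using w pR by (intro exI[of _ "R - norm p"] conjI exI[of _ ?w]) auto
  qed
  ultimately have "?U \<in> smooth_open_nbhds K"
    using op bd by (simp add: smooth_open_nbhds_def)
  then show ?thesis unfolding u_def g_def .
qed

lemma perimeter_le_frac_sobolev_norm:
  fixes f :: "'a::euclidean_space \<Rightarrow> real"
  assumes \<alpha>: "0 < \<alpha>" "\<alpha> < 1" and K: "compact K"
    and f: "f \<in> test_functions" "\<And>x. indicator K x \<le> f x"
  shows "2 * (INF U\<in>smooth_open_nbhds K. frac_perimeter \<alpha> U) \<le> frac_sobolev_norm \<alpha> f"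
proof -
  define I where "I = (INF U\<in>smooth_open_nbhds K. frac_perimeter \<alpha> U)"
  have sf: "smooth_on UNIV f" by (rule test_functionsD(1)[OF f(1)])
  have [measurable]: "f \<in> borel_measurable borel" by (rule smooth_on_borel_measurable[OF sf])
  have "bounded ({x. f x \<noteq> 0} \<union> K)"
    using test_functionsD(2)[OF f(1)] compact_imp_bounded[OF K] by simp
  then obtain R where R: "0 < R" "{x. f x \<noteq> 0} \<union> K \<subseteq> ball 0 R"
    by (rule bounded_subset_ballD[THEN exE]) blast
  have fR: "f x = 0" if "R \<le> norm x" for x using that R(2) by auto
  have KR: "norm x < R" if "x \<in> K" for x using that R(2) by auto
  obtain C where C: "C < \<infinity>" "\<And>(g :: 'a \<Rightarrow> real) L. 0 \<le> L \<Longrightarrow> g \<in> borel_measurable borel \<Longrightarrow>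
    (\<And>x. R + 1 < norm x \<Longrightarrow> g x = 0) \<Longrightarrow> (\<And>x h. \<bar>g (x + h) - g x\<bar> \<le> L * min 1 (norm h)) \<Longrightarrow>
    frac_sobolev_norm \<alpha> g \<le> ennreal L * C"
    using frac_sobolev_norm_Lipschitz_le[OF \<alpha>] by blast
  have est: "2 * I * ennreal (1 - 2 * \<epsilon>) \<le> frac_sobolev_norm \<alpha> f + ennreal (2 * \<epsilon>) * C"
    if \<epsilon>: "0 < \<epsilon>" "\<epsilon> < 1 / 2" for \<epsilon>
  proof -
    let ?P = "\<lambda>a. AE t in lborel. \<forall>x. f x + a \<bullet> x = t \<longrightarrow> (\<exists>h. frechet_derivative f (at x) h + a \<bullet> h \<noteq> 0)"
    \<comment> \<open>The exceptional \<open>a\<close> form a null set, whereas a ball of positive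
      radius has positive measure. The radius is chosen so that \<open>norm a * (R + 2)\<close>
      stays below \<epsilon>.\<close>
    have "\<exists>a\<in>ball 0 (\<epsilon> / (R + 2)). ?P a"
    proof (rule ccontr)
      assume no: "\<not> (\<exists>a\<in>ball 0 (\<epsilon> / (R + 2)). ?P a)"
      have "AE a in lborel. a \<notin> ball (0::'a) (\<epsilon> / (R + 2))"
        by (rule eventually_mono[OF AE_regular_value_linear_perturbation[OF sf]]) (use no in blast)
      then have "ball (0::'a) (\<epsilon> / (R + 2)) \<in> null_sets lborel"
        by (subst (asm) AE_iff_null_sets[symmetric]) auto
      then show False
        using content_ball_pos[of "\<epsilon> / (R + 2)" "0::'a"] \<epsilon> R(1)
        by (simp add: null_sets_def measure_def)
    qed
    then obtain a where a: "norm a < \<epsilon> / (R + 2)" and reg: "?P a" by auto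
    have aR: "norm a * (R + 2) \<le> \<epsilon>" using a R(1) by (simp add: field_simps)
    define g where "g x = max 0 (min 1 (R + 1 - norm x)) * (a \<bullet> x)" for x
    define u where "u x = f x + g x" for x
    note g_Lipschitz = cutoff_linear_Lipschitz[OF R(1), where a=a, folded g_def]
    have [measurable]: "g \<in> borel_measurable borel" "u \<in> borel_measurable borel"
      unfolding u_def g_def by measurable
    have "AE t in lborel. 2 * I * indicator {\<epsilon><..<1 - \<epsilon>} t \<le> frac_sobolev_norm \<alpha> (indicator {x. t < u x})"
      using reg
    proof (elim AE_mp, intro AE_I2 impI)
      fix t
      assume t: "\<forall>x. f x + a \<bullet> x = t \<longrightarrow> (\<exists>h. frechet_derivative f (at x) h + a \<bullet> h \<noteq> 0)"
      show "2 * I * indicator {\<epsilon><..<1 - \<epsilon>} t \<le> frac_sobolev_norm \<alpha> (indicator {x. t < u x})"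
      proof (cases "t \<in> {\<epsilon><..<1 - \<epsilon>}")
        case True
        have "{x. t < u x} \<in> smooth_open_nbhds K"
          unfolding u_def g_def
          by (rule superlevel_in_smooth_open_nbhds[OF sf fR f(2) R(1) KR aR]) (use True t in auto)
        then have "I \<le> frac_perimeter \<alpha> {x. t < u x}"
          unfolding I_def by (rule INF_lower)
        then show ?thesis
          using True by (simp add: frac_sobolev_norm_indicator mult_left_mono)
      qed simp
    qed
    then have "(\<integral>\<^sup>+t. 2 * I * indicator {\<epsilon><..<1 - \<epsilon>} t \<partial>lborel) \<le>
        (\<integral>\<^sup>+t. frac_sobolev_norm \<alpha> (indicator {x. t < u x}) \<partial>lborel)"
      by (rule nn_integral_mono_AE)
    also have "\<dots> = frac_sobolev_norm \<alpha> u"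
      by (rule frac_sobolev_norm_coarea[symmetric]) simp
    also have "\<dots> \<le> frac_sobolev_norm \<alpha> f + frac_sobolev_norm \<alpha> g"
      unfolding u_def by (rule frac_sobolev_norm_add_le) simp_all
    also have "frac_sobolev_norm \<alpha> g \<le> ennreal (2 * \<epsilon>) * C"
    proof (rule C(2))
      show "g x = 0" if "R + 1 < norm x" for x
        using that by (simp add: g_def)
      \<comment> \<open>Two values of size at most \<epsilon> differ by at most
        \<open>2 * \<epsilon>\<close>, which settles large \<open>h\<close>; for small
        \<open>h\<close> the Lipschitz constant is at most \<epsilon>.\<close>
      show "\<bar>g (x + h) - g x\<bar> \<le> 2 * \<epsilon> * min 1 (norm h)" for x h
      proof -
        have "\<bar>g (x + h)\<bar> \<le> \<epsilon>" "\<bar>g x\<bar> \<le> \<epsilon>"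
          using order.trans[OF g_Lipschitz(1) aR] by blast+
        then have 1: "\<bar>g (x + h) - g x\<bar> \<le> 2 * \<epsilon>" by linarith
        have "\<bar>g (x + h) - g x\<bar> \<le> norm a * (R + 2) * norm h"
          using g_Lipschitz(2)[of "x + h" x] by simp
        also have "\<dots> \<le> (2 * \<epsilon>) * norm h"
          using aR \<epsilon>(1) by (intro mult_right_mono) auto
        finally show ?thesis using 1 by (simp add: min_def)
      qed
    qed (use \<epsilon> in simp_all)
    finally show ?thesis
      using \<epsilon> by (simp add: nn_integral_cmult algebra_simps)
  qed
  have ev: "\<forall>\<^sub>F \<epsilon> in at_right 0. 2 * I * ennreal (1 - 2 * \<epsilon>) \<le> frac_sobolev_norm \<alpha> f + ennreal (2 * \<epsilon>) * C"
    using est by (intro eventually_at_rightI[of 0 "1 / 2"]) auto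
  have "((\<lambda>\<epsilon>. ennreal (1 - 2 * \<epsilon>)) \<longlongrightarrow> ennreal (1 - 2 * 0)) (at_right 0)"
    "((\<lambda>\<epsilon>. ennreal (2 * \<epsilon>)) \<longlongrightarrow> ennreal (2 * 0)) (at_right 0)"
    by (intro tendsto_ennrealI tendsto_intros)+
  \<comment> \<open>Multiplication on \<open>ennreal\<close> fails to be continuous only at 0 times
    infinity. The possibly infinite \<open>2 * I\<close> meets the limit 1, and the limit 0 meets
    the finite \<open>C\<close>.\<close>
  then have "((\<lambda>\<epsilon>. 2 * I * ennreal (1 - 2 * \<epsilon>)) \<longlongrightarrow> 2 * I * 1) (at_right 0)"
    "((\<lambda>\<epsilon>. frac_sobolev_norm \<alpha> f + ennreal (2 * \<epsilon>) * C) \<longlongrightarrow> frac_sobolev_norm \<alpha> f + 0 * C) (at_right 0)"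
    using C(1) by (intro tendsto_add tendsto_mult_ennreal tendsto_const; force)+
  from tendsto_le[OF _ this(2,1) ev] show ?thesis
    by (simp add: I_def)
qed

theorem theorem2:
  fixes K :: "(real ^ 'n) set" and \<alpha> :: real
  assumes "0 < \<alpha>" and "\<alpha> < 1" and "compact K"
  shows "frac_sobolev_cap \<alpha> K = 2 * (INF U\<in>smooth_open_nbhds K. frac_perimeter \<alpha> U)"
proof (rule antisym)
  \<comment> \<open>Halving the capacity lets \<open>INF_greatest\<close> act on the bare infimum,
    so the factor 2 need not be moved through it.\<close>
  have two: "2 * (x / 2) = x" for x :: ennreal
    by (simp add: ennreal_times_divide mult.commute[of 2] ennreal_mult_divide_eq)
  have "frac_sobolev_cap \<alpha> K / 2 \<le> frac_perimeter \<alpha> U" if "U \<in> smooth_open_nbhds K" for U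
    using frac_sobolev_cap_le_perimeter[OF assms(3), of U \<alpha>] that
    by (simp add: smooth_open_nbhds_def divide_le_posI_ennreal mult.commute)
  then have "frac_sobolev_cap \<alpha> K / 2 \<le> (INF U\<in>smooth_open_nbhds K. frac_perimeter \<alpha> U)"
    by (rule INF_greatest)
  from mult_left_mono[OF this, of 2]
  show "frac_sobolev_cap \<alpha> K \<le> 2 * (INF U\<in>smooth_open_nbhds K. frac_perimeter \<alpha> U)"
    by (simp add: two)
  show "2 * (INF U\<in>smooth_open_nbhds K. frac_perimeter \<alpha> U) \<le> frac_sobolev_cap \<alpha> K"
    unfolding frac_sobolev_cap_def
    by (intro INF_greatest perimeter_le_frac_sobolev_norm assms) auto
qed

end
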